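(* Let $(X_k)_{k\ge 0}$ be a Markov chain on $\Omega$ with transition kernel $\mathsf{M}$ and arbitrary initial law $\mu$, where $\mathsf{M}$, $\mathscr{X}$, $\mu_0$, $\delta_0$ are as in the context. Let $\varphi\in\mathscr{X}$ be real-valued and nonzero, with dynamical variance $\sigma^2(\varphi)$ (defined in the context), let $a>0$, and set $\hat\mu_n(\varphi)=\frac1n\sum_{k=1}^n\varphi(X_k)$. Whenever $n\ge 1+\frac{\log 100}{-\log(1-\delta_0/13)}$ is an integer, $U\ge\sigma^2(\varphi)$, and \[a\le\frac{U}{\lVert\varphi\rVert}\log\Big(1+\frac{\delta_0^2}{12+13\delta_0}\Big),\] one has \[\mathbb{P}_\mu\big[\lvert\hat\mu_n(\varphi)-\mu_0(\varphi)\rvert\ge a\big]\le 2.637\,\exp\Big(-n\cdot\Big(\frac{a^2}{2U}-10(1+\delta_0^{-1})^2\,\frac{\lVert\varphi\rVert^3a^3}{U^3}\Big)\Big).\] Moreover, given an upper bound $S\ge\sigma^2(\varphi)$, the right-hand side of this inequality, as a function of $U\in\Big[\max\Big(S,\frac{a\lVert\varphi\rVert}{\log(1+\delta_0^2/(12+13\delta_0))}\Big),\infty\Big)$, is minimized at \[U_{\min}:=\max\Big(S,\ \sqrt{a}\cdot\sqrt{60}\,(1+\delta_0^{-1})\lVert\varphi\rVert^{3/2},\ a\cdot\frac{\lVert\varphi\rVert}{\log(1+\delta_0^2/(12+13\delta_0))}\Big).\]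
   Context: $\Omega$ is a Polish metric space with its Borel $\sigma$-algebra; $\mathsf{M}=(m_x)_{x\in\Omega}$ is a transition kernel on $\Omega$ (each $m_x$ is a Borel probability measure); a Markov chain $(X_k)_{k\ge0}$ follows $\mathsf{M}$ if, conditionally on $X_k=x$, $X_{k+1}$ has law $m_x$. $\mathbb{P}_\mu$ denotes probability when $X_0\sim\mu$. We write $\nu(f)=\int f\,d\nu$. $\mathscr{X}$ is a Banach space of (Borel measurable) functions $\Omega\to\mathbb{R}$ (or $\Omega\to\mathbb{C}$) with norm $\lVert\cdot\rVert$ such that: (1) $\lVert f\rVert\ge\lVert f\rVert_\infty$ (uniform norm) for all $f\in\mathscr{X}$; (2) $\mathscr{X}$ is a Banach algebra: $\lVert fg\rVert\le\lVert f\rVert\lVert g\rVert$; (3) $\mathscr{X}$ contains the constant functions and $\lVert\mathbf{1}\rVert=1$, where $\mathbf{1}$ is the constant function $1$. The averaging operator is $L_0f(x)=\int_\Omega f(y)\,dm_x(y)$. It is assumed that $L_0$ is a bounded operator $\mathscr{X}\to\mathscr{X}$ of operator norm $\lVert L_0\rVert=1$, and that it is contracting with gap $\delta_0\in(0,1]$: there is a closed hyperplane $G_0\subset\mathscr{X}$ with $\lVert L_0f\rVert\le(1-\delta_0)\lVert f\rVert$ for all $f\in G_0$. $\mu_0$ denotes a stationary probability measure of $\mathsf{M}$ (so $\mu_0(L_0f)=\mu_0(f)$ for $f\in\mathscr{X}$), which exists and is unique as a linear form on $\mathscr{X}$, and $G_0=\{f\in\mathscr{X}:\mu_0(f)=0\}$.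 With $\bar\varphi=\varphi-\mu_0(\varphi)$, the dynamical variance is \[\sigma^2(\varphi)=\mu_0(\varphi^2)-(\mu_0(\varphi))^2+2\sum_{k\ge1}\mu_0(\varphi\,L_0^k\bar\varphi).\] *)

theory Defs
  imports "HOL-Probability.Probability"
begin

text \<open>
  The Banach space of functions is a Banach-space type \<^typ>\<open>'x\<close>; \<^term>\<open>ev f\<close> is the function on the
  state space that is denoted by \<^term>\<open>f\<close>. Submultiplicativity of the norm, the normalisation
  of the norm of the constant function 1, and completeness come from the type classes
  \<^class>\<open>real_normed_algebra_1\<close> and \<^class>\<open>banach\<close>. The scalar field \<^typ>\<open>'k\<close> is any complete
  normed field over the reals, that is (up to isometric isomorphism) either the reals or the complex
  numbers; \<^term>\<open>scl\<close> is multiplication by such scalars. Constant functions are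
  \<^term>\<open>ev (scl c 1)\<close>.
\<close>

locale banach_function_algebra =
  fixes ev :: "'x :: {real_normed_algebra_1, banach} \<Rightarrow> 'a :: polish_space \<Rightarrow>
                 'k :: {real_normed_field, banach, second_countable_topology}"
    and scl :: "'k \<Rightarrow> 'x \<Rightarrow> 'x"
  assumes inj_ev: "inj ev"
    and ev_measurable: "ev f \<in> borel_measurable borel"
    and ev_add: "ev (f + g) = (\<lambda>x. ev f x + ev g x)"
    and ev_scaleR: "ev (r *\<^sub>R f) = (\<lambda>x. r *\<^sub>R ev f x)"
    and ev_mult: "ev (f * g) = (\<lambda>x. ev f x * ev g x)"
    and ev_one: "ev 1 = (\<lambda>_. 1)"
    and ev_scl: "ev (scl c f) = (\<lambda>x. c * ev f x)"
    and norm_scl: "norm (scl c f) = norm c * norm f"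
    and norm_ev_le: "norm (ev f x) \<le> norm f"

definition closed_hyperplane ::
    "('k :: field \<Rightarrow> 'x \<Rightarrow> 'x) \<Rightarrow> 'x :: {ab_group_add, topological_space} set \<Rightarrow> bool" where
  "closed_hyperplane scl G \<longleftrightarrow> closed G \<and>
     (\<exists>l. Vector_Spaces.linear scl (*) l \<and> l \<noteq> (\<lambda>_. 0) \<and> G = {f. l f = 0})"

definition averaging ::
    "('a \<Rightarrow> 'a measure) \<Rightarrow> ('a \<Rightarrow> 'b :: {banach, second_countable_topology}) \<Rightarrow> 'a \<Rightarrow> 'b" where
  "averaging m f x = (\<integral>y. f y \<partial>m x)"

locale contracting_kernel = banach_function_algebra ev scl
  for ev :: "'x :: {real_normed_algebra_1, banach} \<Rightarrow> 'a :: polish_space \<Rightarrow>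
               'k :: {real_normed_field, banach, second_countable_topology}"
    and scl :: "'k \<Rightarrow> 'x \<Rightarrow> 'x" +
  fixes m :: "'a \<Rightarrow> 'a measure"
    and L0 :: "'x \<Rightarrow> 'x"
    and \<mu>0 :: "'a measure"
    and G0 :: "'x set"
    and \<delta>0 :: real
  assumes kernel: "m \<in> borel \<rightarrow>\<^sub>M prob_algebra borel"
    and ev_L0: "ev (L0 f) = averaging m (ev f)"
    and bounded_L0: "bounded_linear L0"
    and onorm_L0: "onorm L0 = 1"
    and gap: "0 < \<delta>0" "\<delta>0 \<le> 1"
    and hyperplane_G0: "closed_hyperplane scl G0"
    and contraction: "f \<in> G0 \<Longrightarrow> norm (L0 f) \<le> (1 - \<delta>0) * norm f"
    and prob_\<mu>0: "\<mu>0 \<in> space (prob_algebra borel)"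
    and stationary: "\<mu>0 \<bind> m = \<mu>0"
    and G0_eq: "G0 = {f. (\<integral>x. ev f x \<partial>\<mu>0) = 0}"

definition past :: "'w measure \<Rightarrow> (nat \<Rightarrow> 'w \<Rightarrow> 'a :: topological_space) \<Rightarrow> nat \<Rightarrow> 'w measure" where
  "past P X k = sigma (space P) {X i -` A \<inter> space P | i A. i \<le> k \<and> A \<in> sets borel}"

definition markov_chain ::
    "'w measure \<Rightarrow> ('a \<Rightarrow> 'a measure) \<Rightarrow> 'a measure \<Rightarrow> (nat \<Rightarrow> 'w \<Rightarrow> 'a :: polish_space) \<Rightarrow> bool" where
  "markov_chain P m \<mu> X \<longleftrightarrow> prob_space P \<and> (\<forall>k. X k \<in> P \<rightarrow>\<^sub>M borel) \<and> distr P borel (X 0) = \<mu> \<and>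
     (\<forall>k. \<forall>A \<in> sets borel. AE w in P.
        real_cond_exp P (past P X k) (\<lambda>w. indicator A (X (Suc k) w)) w = measure (m (X k w)) A)"

text \<open>
  The summation index is shifted by one. For a function in the algebra the series converges, because
  \<^term>\<open>averaging m\<close> contracts the centred functions geometrically.
\<close>

definition dyn_variance :: "('a \<Rightarrow> 'a measure) \<Rightarrow> 'a measure \<Rightarrow> ('a \<Rightarrow> real) \<Rightarrow> real" where
  "dyn_variance m \<mu>0 \<phi> =
     (\<integral>x. (\<phi> x)\<^sup>2 \<partial>\<mu>0) - (\<integral>x. \<phi> x \<partial>\<mu>0)\<^sup>2 +
     2 * (\<Sum>k. \<integral>x. \<phi> x * (averaging m ^^ Suc k) (\<lambda>y. \<phi> y - (\<integral>z. \<phi> z \<partial>\<mu>0)) x \<partial>\<mu>0)"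

definition empirical_mean :: "(nat \<Rightarrow> 'w \<Rightarrow> 'a) \<Rightarrow> ('a \<Rightarrow> real) \<Rightarrow> nat \<Rightarrow> 'w \<Rightarrow> real" where
  "empirical_mean X \<phi> n w = (1 / real n) * (\<Sum>k=1..n. \<phi> (X k w))"

definition threshold :: "real \<Rightarrow> real" where
  "threshold \<delta>0 = ln (1 + \<delta>0\<^sup>2 / (12 + 13 * \<delta>0))"

text \<open>In the next definition \<^term>\<open>N\<close> stands for the norm of the observable.\<close>

definition tail_bound :: "nat \<Rightarrow> real \<Rightarrow> real \<Rightarrow> real \<Rightarrow> real \<Rightarrow> real" where
  "tail_bound n \<delta>0 N a U =
     2.637 * exp (- real n * (a\<^sup>2 / (2 * U) - 10 * (1 + inverse \<delta>0)\<^sup>2 * (N ^ 3 * a ^ 3 / U ^ 3)))"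

end

theory Submission
  imports Defs
begin

text \<open>
  Write \<open>S\<^sub>n = \<phi>(X\<^sub>1) + ... + \<phi>(X\<^sub>n)\<close> and put \<open>t = a / U\<close>. By the Chernoff inequality, applied to \<open>t S\<^sub>n\<close> and to
  \<open>- t S\<^sub>n\<close>, it is enough to bound the exponential moments of \<open>S\<^sub>n\<close>. By the Markov property these are
  averages, over the initial law, of the function \<open>L\<^sub>t\<^sup>n 1\<close>, where \<open>L\<^sub>t g = L\<^sub>0 (e\<^bsup>t\<phi>\<^esup> g)\<close> is the twisted
  averaging operator (\<open>nn_integral_exp_sum\<close>). As the uniform norm is at most the norm of the algebra, a
  bound on the norm of \<open>L\<^sub>t\<^sup>n 1\<close> suffices, and this is a question about one operator on a Banach algebra.
  There the hypothesis on \<open>a\<close> says that \<open>\<epsilon> = exp (t \<parallel>\<phi>\<parallel>) - 1\<close> is at most \<open>\<delta>\<^sub>0\<^sup>2 / (12 + 13 \<delta>\<^sub>0)\<close>.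

  The iterates are followed in normalised form, \<open>L\<^sub>t\<^sup>n 1 = \<lambda>\<^sub>0 ... \<lambda>\<^bsub>n-1\<^esub> (1 + g\<^sub>n)\<close> with \<open>\<mu>\<^sub>0(g\<^sub>n) = 0\<close>. One step of
  this normalised iteration contracts by \<open>1 - \<delta>\<^sub>0\<close> up to an error of order \<open>\<epsilon>\<close>, so it preserves the ball of
  radius \<open>\<rho> = 2 \<epsilon> / \<delta>\<^sub>0\<close> (\<open>renormalise_admissible\<close>); hence \<open>1 + g\<^sub>n\<close> costs only a constant factor. The growth
  factors are \<open>\<lambda>\<^sub>n = \<mu>\<^sub>0(e\<^bsup>t\<phi>\<^esup> (1 + g\<^sub>n))\<close>. To first order in \<open>t\<close>, \<open>g\<^sub>n\<close> is close to \<open>t \<psi>\<close>, where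
  \<open>\<psi> = L\<^sub>0 \<phi>' + L\<^sub>0\<^sup>2 \<phi>' + ...\<close> and \<open>\<phi>' = \<phi> - \<mu>\<^sub>0(\<phi>)\<close>; the difference is a transient term that decays like \<open>(1 - \<delta>\<^sub>0)\<^sup>n\<close>
  plus an error of second order (\<open>dev_near_corrector\<close>). Since \<open>\<sigma>\<^sup>2(\<phi>) = \<mu>\<^sub>0(\<phi>\<^sup>2) - \<mu>\<^sub>0(\<phi>)\<^sup>2 + 2 \<mu>\<^sub>0(\<phi> \<psi>)\<close>, expanding
  \<open>\<lambda>\<^sub>n\<close> to second order gives
  \<open>log \<lambda>\<^sub>n \<le> t \<mu>\<^sub>0(\<phi>) + t\<^sup>2 \<sigma>\<^sup>2(\<phi>) / 2 + 10 (1 + 1/\<delta>\<^sub>0)\<^sup>2 (t \<parallel>\<phi>\<parallel>)\<^sup>3 + \<close> transient (\<open>factor_dev_le\<close>). The cubic term absorbs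
  all errors because the dominating one, about \<open>6 (t \<parallel>\<phi>\<parallel>)\<^sup>3 / \<delta>\<^sub>0\<^sup>2\<close>, leaves room to spare. The transients have a
  small sum, and with the factor \<open>1 + \<rho>\<close> they stay below \<open>1.3185\<close>; the two tails give \<open>2 * 1.3185 = 2.637\<close>.

  For the optimisation, in the variable \<open>p = 1 / U\<close> the exponent is \<open>- n\<close> times a cubic \<open>A p - B p\<^sup>3\<close>, which
  increases up to its critical point and decreases beyond it.
\<close>

section \<open>Taylor remainders of the exponential in a Banach algebra\<close>

text \<open>
  The norm of each Taylor coefficient of \<open>exp x\<close> is at most the corresponding coefficient of the real series
  \<open>exp (norm x)\<close>, hence the same holds for the tails.
\<close>

lemma norm_exp_minus_partial_sum_le:
  fixes x :: "'b :: {real_normed_algebra_1, banach}"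
  shows "norm (exp x - (\<Sum>k<n. x ^ k /\<^sub>R fact k)) \<le> exp (norm x) - (\<Sum>k<n. norm x ^ k /\<^sub>R fact k)"
proof -
  have tail: "exp y - (\<Sum>k<n. y ^ k /\<^sub>R fact k) = (\<Sum>k. y ^ (k + n) /\<^sub>R fact (k + n))"
    for y :: "'c :: {real_normed_algebra_1, banach}"
    unfolding exp_def using suminf_minus_initial_segment[OF summable_exp_generic[of y], of n] by simp
  have sm: "summable (\<lambda>k. norm x ^ (k + n) /\<^sub>R fact (k + n))"
    using summable_ignore_initial_segment[OF summable_exp_generic[of "norm x"]] by simp
  have "norm (x ^ (k + n) /\<^sub>R fact (k + n)) \<le> norm x ^ (k + n) /\<^sub>R fact (k + n)" for k
    using norm_power_ineq[of x "k + n"] by (simp add: mult_left_mono)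
  then show ?thesis unfolding tail by (rule norm_suminf_le[OF _ sm])
qed

lemma norm_exp_remainders:
  fixes x :: "'b :: {real_normed_algebra_1, banach}"
  shows "norm (exp x - 1) \<le> exp (norm x) - 1"
    and "norm (exp x - 1 - x) \<le> exp (norm x) - 1 - norm x"
    and "norm (exp x - 1 - x - x\<^sup>2 /\<^sub>R 2) \<le> exp (norm x) - 1 - norm x - (norm x)\<^sup>2 / 2"
proof -
  have s1: "(\<Sum>k<1. y ^ k /\<^sub>R fact k) = 1"
    and s2: "(\<Sum>k<2. y ^ k /\<^sub>R fact k) = 1 + y"
    and s3: "(\<Sum>k<3. y ^ k /\<^sub>R fact k) = 1 + y + y\<^sup>2 /\<^sub>R 2"
    for y :: "'c :: {real_normed_algebra_1, banach}"
    by (simp_all add: numeral_2_eq_2 numeral_3_eq_3)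
  show "norm (exp x - 1) \<le> exp (norm x) - 1"
    using norm_exp_minus_partial_sum_le[of x 1] unfolding s1 .
  show "norm (exp x - 1 - x) \<le> exp (norm x) - 1 - norm x"
    using norm_exp_minus_partial_sum_le[of x 2] unfolding s2 diff_diff_eq .
  show "norm (exp x - 1 - x - x\<^sup>2 /\<^sub>R 2) \<le> exp (norm x) - 1 - norm x - (norm x)\<^sup>2 / 2"
    using norm_exp_minus_partial_sum_le[of x 3] unfolding s3 diff_diff_eq by simp
qed

section \<open>Numerical estimates for small perturbations\<close>

text \<open>
  The bound \<open>exp s - 1 \<le> 1 / 25\<close> is what the smallness condition \<open>\<epsilon> \<le> \<delta>\<^sup>2 / (12 + 13 \<delta>)\<close> becomes in the extreme case
  \<open>\<delta> = 1\<close>. Since \<open>exp \<le> 26 / 25\<close> on the interval in question, the Lagrange form of the remainder gives all constants.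
\<close>

lemma exp_remainder_bounds:
  fixes s :: real
  assumes s: "0 \<le> s" and small: "exp s - 1 \<le> 1 / 25"
  shows "s \<le> 1 / 25" "exp s - 1 \<le> 26 / 25 * s" "exp s - 1 - s \<le> s ^ 2"
    "exp s - 1 - s - s ^ 2 / 2 \<le> s ^ 3 / 3"
    "\<bar>w\<bar> \<le> s \<Longrightarrow> 1 + w + w ^ 2 / 2 - s ^ 3 / 3 \<le> exp w"
proof -
  show s25: "s \<le> 1 / 25" using exp_ge_add_one_self[of s] small by linarith
  have le2: "exp x \<le> 26 / 25" if "\<bar>x\<bar> \<le> s" for x
    proof -
    have "exp x \<le> exp s" using that by simp
    with small show ?thesis by linarith
  qed
  have sum2: "(\<Sum>m<2. u ^ m / fact m) = 1 + u" for u :: real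
    by (simp add: numeral_2_eq_2)
  have sum3: "(\<Sum>m<3. u ^ m / fact m) = 1 + u + u\<^sup>2 / 2" for u :: real
    by (simp add: numeral_2_eq_2 numeral_3_eq_3)
  have fact3: "fact 3 = (6 :: real)" by (simp add: fact_numeral)
  obtain x where x: "\<bar>x\<bar> \<le> s" "exp s = (\<Sum>m<2. s ^ m / fact m) + (exp x / fact 2) * s ^ 2"
    using Maclaurin_exp_le[of s 2] s by auto
  have two: "exp s - 1 - s \<le> 26 / 50 * s ^ 2"
    using x(2) mult_right_mono[OF le2[OF x(1)], of "s ^ 2"] unfolding sum2 by simp
  with zero_le_power2[of s] show "exp s - 1 - s \<le> s ^ 2" by linarith
  have "s ^ 2 \<le> 1 / 25 * s" using mult_right_mono[OF s25 s] by (simp add: power2_eq_square)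
  with two show "exp s - 1 \<le> 26 / 25 * s" using s by linarith
  have three: "exp u - 1 - u - u ^ 2 / 2 \<le> s ^ 3 / 3 \<and> - (s ^ 3 / 3) \<le> exp u - 1 - u - u ^ 2 / 2"
    if u: "\<bar>u\<bar> \<le> s" for u
  proof -
    obtain y where y: "\<bar>y\<bar> \<le> \<bar>u\<bar>" "exp u = (\<Sum>m<3. u ^ m / fact m) + (exp y / fact 3) * u ^ 3"
      using Maclaurin_exp_le[of u 3] by auto
    have "exp u - 1 - u - u ^ 2 / 2 = exp y / 6 * u ^ 3"
      using y(2) unfolding sum3 fact3 by simp
    moreover have "\<bar>exp y / 6 * u ^ 3\<bar> \<le> 1 / 3 * s ^ 3"
      unfolding abs_mult power_abs using le2[of y] y(1) u by (intro mult_mono power_mono) auto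
    ultimately show ?thesis by linarith
  qed
  show "exp s - 1 - s - s ^ 2 / 2 \<le> s ^ 3 / 3" using three[of s] s by simp
  show "1 + w + w ^ 2 / 2 - s ^ 3 / 3 \<le> exp w" if "\<bar>w\<bar> \<le> s" using three[OF that] by linarith
qed

lemma small_exp_imp:
  fixes \<delta> :: real
  assumes "0 < \<delta>" "\<delta> \<le> 1" "\<epsilon> \<le> \<delta>\<^sup>2 / (12 + 13 * \<delta>)"
  shows "\<epsilon> \<le> \<delta> / 25" "\<epsilon> \<le> \<delta>\<^sup>2 / 12"
proof -
  have "\<delta>\<^sup>2 / (12 + 13 * \<delta>) \<le> \<delta>\<^sup>2 / (25 * \<delta>)" using assms by (intro divide_left_mono) auto
  also have "\<dots> = \<delta> / 25" using assms by (simp add: power2_eq_square)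
  finally show "\<epsilon> \<le> \<delta> / 25" using assms by linarith
  have "\<delta>\<^sup>2 / (12 + 13 * \<delta>) \<le> \<delta>\<^sup>2 / 12" using assms by (intro divide_left_mono) auto
  then show "\<epsilon> \<le> \<delta>\<^sup>2 / 12" using assms by linarith
qed

text \<open>
  This is the place where the constant 10 is used. The left-hand side is the second-order expansion of a growth
  factor: \<open>w\<close> stands for \<open>t \<mu>\<^sub>0(\<phi>)\<close>, \<open>v\<close> for \<open>t\<^sup>2 \<sigma>\<^sup>2 / 2\<close>, and the other terms are the errors. With \<open>i = 1 / \<delta>\<close> and up to the
  transient \<open>\<tau>\<close>, the errors are at most \<open>s\<^sup>3 (1/3 + 5 i + 7 i\<^sup>2)\<close>. On the other side \<open>exp (w + v + K)\<close> is at
  least \<open>exp w (1 + v + K)\<close>, which exceeds \<open>1 + w + w\<^sup>2/2 + v\<close> by \<open>(24/25) K\<close> up to terms \<open>s\<^sup>3/3\<close> and \<open>3 s\<^sup>3 i\<close>;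
  and \<open>K = 10 s\<^sup>3 (1 + 2 i + i\<^sup>2)\<close> dominates all of this coefficient by coefficient. The transient enters the exponent
  twice, because \<open>exp (w + v + K)\<close> may be smaller than 1 but is at least 1/2.
\<close>

lemma growth_factor_le_exp:
  fixes \<delta> s w v \<tau> \<epsilon> \<rho> Q :: real
  assumes \<delta>: "0 < \<delta>" "\<delta> \<le> 1" and s: "0 \<le> s"
    and \<epsilon>: "\<epsilon> = exp s - 1" and small: "\<epsilon> \<le> \<delta>\<^sup>2 / (12 + 13 * \<delta>)"
    and \<rho>: "\<rho> = 2 * \<epsilon> / \<delta>"
    and Q: "Q = 2 * (exp s - 1 - s) + 2 * \<epsilon> * \<rho> + \<epsilon> * (1 + \<rho>) * \<rho>"
    and w: "\<bar>w\<bar> \<le> s" and v: "\<bar>v\<bar> \<le> 2 * s\<^sup>2 / \<delta>" and \<tau>: "0 \<le> \<tau>"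
  shows "1 + w + w\<^sup>2 / 2 + v + (exp s - 1 - s - s\<^sup>2 / 2) + s * (Q / \<delta>) + (exp s - 1 - s) * \<rho> + \<tau>
           \<le> exp (w + v + 10 * (1 + 1 / \<delta>)\<^sup>2 * s ^ 3 + 2 * \<tau>)"
proof -
  define i where "i = 1 / \<delta>"
  have i: "1 \<le> i" "\<delta> * i = 1" using \<delta> by (auto simp: i_def)
  note sm = small_exp_imp[OF \<delta> small]
  have \<epsilon>25: "\<epsilon> \<le> 1 / 25" using sm \<delta> by simp
  note B = exp_remainder_bounds[OF s \<epsilon>25[unfolded \<epsilon>]]
  have B2: "\<epsilon> \<le> 26 / 25 * s" using B(2) by (simp add: \<epsilon>)
  have \<epsilon>0: "0 \<le> \<epsilon>" using s by (simp add: \<epsilon>)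
  have e2: "0 \<le> exp s - 1 - s" using exp_ge_add_one_self[of s] by linarith
  have \<rho>i: "\<rho> = 2 * \<epsilon> * i" by (simp add: \<rho> i_def)
  have \<rho>0: "0 \<le> \<rho>" using \<epsilon>0 i by (simp add: \<rho>i)
  have \<rho>1: "\<rho> \<le> 2 / 25" using sm(1) \<delta> by (simp add: \<rho> field_simps)
  have \<rho>s: "\<rho> \<le> 52 / 25 * (s * i)" using mult_right_mono[OF B2, of "2 * i"] i unfolding \<rho>i by simp
  have si: "0 \<le> s * i" using s i by simp
  have Qle: "Q \<le> 2 * s\<^sup>2 + 7 * (s\<^sup>2 * i)"
  proof -
    have "\<epsilon> * \<rho> \<le> 26 / 25 * s * (52 / 25 * (s * i))" using B2 \<rho>s \<epsilon>0 \<rho>0 s by (intro mult_mono) auto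
    then have a: "\<epsilon> * \<rho> \<le> 1352 / 625 * (s\<^sup>2 * i)" by (simp add: power2_eq_square algebra_simps)
    have "\<epsilon> * \<rho> * \<rho> \<le> \<epsilon> * \<rho> * (2 / 25)" using \<rho>1 \<epsilon>0 \<rho>0 by (intro mult_left_mono) auto
    then have "Q \<le> 2 * (exp s - 1 - s) + (3 + 2 / 25) * (\<epsilon> * \<rho>)" unfolding Q by (simp add: algebra_simps)
    also have "\<dots> \<le> 2 * s\<^sup>2 + (3 + 2 / 25) * (1352 / 625 * (s\<^sup>2 * i))"
      using B(3) a by (intro add_mono mult_left_mono) auto
    also have "\<dots> \<le> 2 * s\<^sup>2 + 7 * (s\<^sup>2 * i)" using i by simp
    finally show ?thesis .
  qed
  have t1: "s * (Q / \<delta>) \<le> 2 * (s ^ 3 * i) + 7 * (s ^ 3 * i\<^sup>2)"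
  proof -
    have "s * (Q / \<delta>) = s * i * Q" by (simp add: i_def)
    also have "\<dots> \<le> s * i * (2 * s\<^sup>2 + 7 * (s\<^sup>2 * i))" by (rule mult_left_mono[OF Qle si])
    finally show ?thesis by (simp add: power2_eq_square power3_eq_cube algebra_simps)
  qed
  have t2: "(exp s - 1 - s) * \<rho> \<le> 52 / 25 * (s ^ 3 * i)"
  proof -
    have "(exp s - 1 - s) * \<rho> \<le> s\<^sup>2 * (52 / 25 * (s * i))" using B(3) \<rho>s e2 \<rho>0 by (intro mult_mono) auto
    then show ?thesis by (simp add: power2_eq_square power3_eq_cube algebra_simps)
  qed
  define K where "K = 10 * (1 + 1 / \<delta>)\<^sup>2 * s ^ 3"
  have K: "K = 10 * s ^ 3 + 20 * (s ^ 3 * i) + 10 * (s ^ 3 * i\<^sup>2)"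
    by (simp add: K_def i_def[symmetric] power2_eq_square algebra_simps)
  have s3: "0 \<le> s ^ 3" "0 \<le> s ^ 3 * i" "0 \<le> s ^ 3 * i\<^sup>2" using s i by auto
  have K0: "0 \<le> K" using s3 by (simp add: K)
  have vi: "\<bar>v\<bar> \<le> 2 * (s\<^sup>2 * i)" using v by (simp add: i_def)
  have ew: "\<bar>exp w - 1\<bar> \<le> \<epsilon>"
    using norm_exp_remainders(1)[of w] exp_le_cancel_iff[of "\<bar>w\<bar>" s] w unfolding \<epsilon> real_norm_def by linarith
  have "\<bar>(exp w - 1) * (v + K)\<bar> \<le> 1 / 25 * K + 3 * (s ^ 3 * i)"
  proof -
    have "\<bar>(exp w - 1) * (v + K)\<bar> \<le> \<bar>exp w - 1\<bar> * \<bar>v\<bar> + \<bar>exp w - 1\<bar> * K"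
      unfolding abs_mult distrib_left[symmetric] using K0 by (intro mult_left_mono) auto
    also have "\<dots> \<le> (26 / 25 * s) * (2 * (s\<^sup>2 * i)) + 1 / 25 * K"
      using ew B2 \<epsilon>25 vi K0 s by (intro add_mono mult_mono) auto
    also have "\<dots> \<le> 1 / 25 * K + 3 * (s ^ 3 * i)"
      using s3 by (simp add: power2_eq_square power3_eq_cube algebra_simps)
    finally show ?thesis .
  qed
  moreover have "exp w * (1 + (v + K)) \<le> exp (w + v + K)"
    unfolding add.assoc exp_add[of w "v + K"] by (intro mult_left_mono exp_ge_add_one_self) simp
  moreover have "exp w * (1 + (v + K)) = exp w + (v + K) + (exp w - 1) * (v + K)"
    by (simp add: algebra_simps)
  ultimately have lower: "exp w + v + 24 / 25 * K - 3 * (s ^ 3 * i) \<le> exp (w + v + K)" by linarith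
  have main: "1 + w + w\<^sup>2 / 2 + v + (exp s - 1 - s - s\<^sup>2 / 2) + s * (Q / \<delta>) + (exp s - 1 - s) * \<rho>
      \<le> exp (w + v + K)"
    using lower B(5)[OF w] B(4) t1 t2 s3 K by linarith
  \<comment> \<open>This lower bound turns the additive transient into a multiplicative one.\<close>
  have half: "1 / 2 \<le> exp (w + v + K)"
  proof -
    have "s\<^sup>2 * i = s * i * s" by (simp add: power2_eq_square)
    also have "\<dots> \<le> 1 / 25 * (1 / 25)"
    proof (intro mult_mono)
      have "s \<le> \<epsilon>" using e2 \<epsilon> by linarith
      then show "s * i \<le> 1 / 25" using sm(1) \<delta> by (simp add: i_def field_simps)
    qed (use B(1) s in auto)
    finally have "- 1 / 2 \<le> w + v" using w vi B(1) by linarith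
    then show ?thesis using exp_ge_add_one_self[of "w + v + K"] K0 by linarith
  qed
  define E where "E = exp (w + v + K)"
  have "E * (1 + 2 * \<tau>) \<le> E * exp (2 * \<tau>)"
    by (intro mult_left_mono exp_ge_add_one_self) (simp add: E_def)
  moreover have "1 / 2 * (2 * \<tau>) \<le> E * (2 * \<tau>)" using half \<tau> unfolding E_def by (intro mult_right_mono) auto
  ultimately have "E + \<tau> \<le> E * exp (2 * \<tau>)" by (simp add: distrib_left)
  also have "\<dots> = exp (w + v + K + 2 * \<tau>)" unfolding E_def by (rule exp_add[symmetric])
  finally show ?thesis using main unfolding K_def[symmetric] E_def by linarith
qed

text \<open>
  The last inequality says that the ball of radius \<open>\<rho>\<close> is preserved by the normalised twisted iteration, which moves a
  centred element of norm at most \<open>\<rho>\<close> by the gap contraction, a perturbation of size \<open>\<epsilon> (1 + \<rho>)\<close> and a rescaling. It amounts to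
  \<open>(1 + \<rho>) (2 - 2 \<delta> + \<rho>) \<le> 2\<close>. The smallness of \<open>\<epsilon>\<close> gives \<open>\<rho> \<le> \<delta> / 6\<close>, so the loss \<open>2 \<delta>\<close> outweighs
  what the two occurrences of \<open>\<rho>\<close> add.
\<close>

lemma perturbed_radius_invariant:
  fixes \<delta> \<epsilon> \<rho> :: real
  assumes \<delta>: "0 < \<delta>" "\<delta> \<le> 1" and \<epsilon>: "0 \<le> \<epsilon>" and small: "\<epsilon> \<le> \<delta>\<^sup>2 / (12 + 13 * \<delta>)"
    and \<rho>: "\<rho> = 2 * \<epsilon> / \<delta>"
  shows "\<rho> \<le> 2 / 25" "\<epsilon> * (1 + \<rho>) \<le> 1 / 2"
    "(1 - \<delta>) * \<rho> + 2 * (1 - \<delta>) * (\<epsilon> * (1 + \<rho>)) \<le> (1 - \<epsilon> * (1 + \<rho>)) * \<rho>"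
proof -
  note sm = small_exp_imp[OF \<delta> small]
  show \<rho>1: "\<rho> \<le> 2 / 25" using sm(1) \<delta> by (simp add: \<rho> field_simps)
  have \<rho>0: "0 \<le> \<rho>" using \<epsilon> \<delta> by (simp add: \<rho>)
  have "\<epsilon> \<le> 1 / 25" using sm(1) \<delta> by simp
  then have "\<epsilon> * (1 + \<rho>) \<le> 1 / 25 * (1 + 2 / 25)" using \<rho>1 \<rho>0 \<epsilon> by (intro mult_mono) auto
  then show "\<epsilon> * (1 + \<rho>) \<le> 1 / 2" by simp
  have \<rho>6: "\<rho> \<le> \<delta> / 6" using sm(2) \<delta> by (simp add: \<rho> field_simps power2_eq_square)
  have "(1 + \<rho>) * (2 - 2 * \<delta> + \<rho>) \<le> (1 + \<delta> / 6) * (2 - 2 * \<delta> + \<delta> / 6)"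
    using \<rho>6 \<rho>0 \<delta> by (intro mult_mono) auto
  also have "\<dots> \<le> 2" using \<delta> mult_nonneg_nonneg[of \<delta> \<delta>] by (simp add: algebra_simps)
  finally have "\<epsilon> * ((1 + \<rho>) * (2 - 2 * \<delta> + \<rho>)) \<le> \<epsilon> * 2" using \<epsilon> by (intro mult_left_mono) auto
  also have "\<dots> = \<delta> * \<rho>" using \<delta> by (simp add: \<rho>)
  finally show "(1 - \<delta>) * \<rho> + 2 * (1 - \<delta>) * (\<epsilon> * (1 + \<rho>)) \<le> (1 - \<epsilon> * (1 + \<rho>)) * \<rho>"
    by (simp add: algebra_simps)
qed

section \<open>The corrector of a contracting operator\<close>

text \<open>
  The spectral argument uses only a real Banach algebra with a normalised functional \<open>M\<close> and an operator \<open>L\<close>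
  that preserves \<open>M\<close> and contracts its kernel. The structure lives on a closed subalgebra \<open>V\<close>, which will consist of the
  real-valued elements, so that \<open>M\<close> can take real values even if the function algebra is complex.
\<close>

locale gap_subalgebra =
  fixes V :: "'x :: {real_normed_algebra_1, banach} set"
    and M :: "'x \<Rightarrow> real"
    and L :: "'x \<Rightarrow> 'x"
    and \<delta> :: real
  assumes V_subspace: "subspace V"
    and V_closed: "closed V"
    and V_one: "1 \<in> V"
    and V_mult: "g \<in> V \<Longrightarrow> h \<in> V \<Longrightarrow> g * h \<in> V"
    and V_L: "g \<in> V \<Longrightarrow> L g \<in> V"
    and L_linear: "bounded_linear L"
    and L_one: "L 1 = 1"
    and M_add: "g \<in> V \<Longrightarrow> h \<in> V \<Longrightarrow> M (g + h) = M g + M h"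
    and M_scale: "g \<in> V \<Longrightarrow> M (r *\<^sub>R g) = r * M g"
    and M_one: "M 1 = 1"
    and M_le: "g \<in> V \<Longrightarrow> \<bar>M g\<bar> \<le> norm g"
    and M_L: "g \<in> V \<Longrightarrow> M (L g) = M g"
    and delta: "0 < \<delta>" "\<delta> \<le> 1"
    and L_contracts: "g \<in> V \<Longrightarrow> M g = 0 \<Longrightarrow> norm (L g) \<le> (1 - \<delta>) * norm g"
begin

lemmas L_simps = linear_simps[OF L_linear]

lemma V_add: "g \<in> V \<Longrightarrow> h \<in> V \<Longrightarrow> g + h \<in> V"
  and V_diff: "g \<in> V \<Longrightarrow> h \<in> V \<Longrightarrow> g - h \<in> V"
  and V_scale: "g \<in> V \<Longrightarrow> r *\<^sub>R g \<in> V"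
  and V_sum: "(\<And>i. i \<in> I \<Longrightarrow> w i \<in> V) \<Longrightarrow> (\<Sum>i\<in>I. w i) \<in> V"
  using V_subspace by (auto intro: subspace_add subspace_diff subspace_scale subspace_sum)

lemma M_diff: "g \<in> V \<Longrightarrow> h \<in> V \<Longrightarrow> M (g - h) = M g - M h"
  using M_add[of g "(-1) *\<^sub>R h"] M_scale[of h "-1"] V_scale[of h "-1"] by simp

lemma V_power: "g \<in> V \<Longrightarrow> g ^ k \<in> V"
  by (induction k) (auto intro: V_one V_mult)

lemma V_sums: "(\<And>k. w k \<in> V) \<Longrightarrow> w sums y \<Longrightarrow> y \<in> V"
  unfolding sums_def by (rule closed_sequentially[OF V_closed]) (auto intro: V_sum)

lemma V_exp: "g \<in> V \<Longrightarrow> exp g \<in> V"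
  by (rule V_sums[OF _ exp_converges]) (auto intro: V_scale V_power)

lemmas V_intros = V_one V_add V_diff V_scale V_mult V_L V_power V_exp

definition centre :: "'x \<Rightarrow> 'x" where
  "centre g = g - M g *\<^sub>R 1"

lemma centre_V [intro]: "g \<in> V \<Longrightarrow> centre g \<in> V"
  unfolding centre_def by (intro V_intros)

lemma M_centre: "g \<in> V \<Longrightarrow> M (centre g) = 0"
  unfolding centre_def by (simp add: M_diff M_scale M_one V_intros)

lemma norm_L_centre: "g \<in> V \<Longrightarrow> norm (L (centre g)) \<le> 2 * (1 - \<delta>) * norm g"
proof -
  assume g: "g \<in> V"
  have "norm (centre g) \<le> norm g + \<bar>M g\<bar>"
    unfolding centre_def using norm_triangle_ineq4[of g "M g *\<^sub>R 1"] by simp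
  then have "norm (centre g) \<le> 2 * norm g" using M_le[OF g] by simp
  then have "(1 - \<delta>) * norm (centre g) \<le> (1 - \<delta>) * (2 * norm g)"
    using delta by (intro mult_left_mono) auto
  with L_contracts[OF centre_V[OF g] M_centre[OF g]] show ?thesis by (simp add: algebra_simps)
qed

text \<open>
  The corrector is the solution \<open>\<psi>\<close>, with mean zero, of the Poisson equation \<open>\<psi> - L \<psi> = L (g - M g)\<close>. It is the
  first-order term of the leading eigenvector of the twisted operator.
\<close>

definition corrector :: "'x \<Rightarrow> 'x" where
  "corrector g = (\<Sum>k. (L ^^ Suc k) (centre g))"

lemma iterate_centre:
  assumes g: "g \<in> V"
  shows "(L ^^ k) (centre g) \<in> V" "M ((L ^^ k) (centre g)) = 0"
  by (induction k) (use g in \<open>auto intro: V_L simp: M_centre M_L\<close>)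

lemma norm_iterate_centre:
  assumes g: "g \<in> V"
  shows "norm ((L ^^ Suc k) (centre g)) \<le> 2 * norm g * (1 - \<delta>) ^ Suc k"
proof (induction k)
  case 0
  show ?case using norm_L_centre[OF g] by (simp add: algebra_simps)
next
  case (Suc k)
  have "norm ((L ^^ Suc (Suc k)) (centre g)) \<le> (1 - \<delta>) * norm ((L ^^ Suc k) (centre g))"
    using L_contracts[of "(L ^^ Suc k) (centre g)"] iterate_centre[OF g, of "Suc k"] by simp
  also have "\<dots> \<le> (1 - \<delta>) * (2 * norm g * (1 - \<delta>) ^ Suc k)"
    using delta by (intro mult_left_mono Suc) auto
  finally show ?case by (simp add: algebra_simps)
qed

lemma gap_geometric_sums: "(\<lambda>k. 2 * norm g * (1 - \<delta>) ^ Suc k) sums (2 * norm g * (1 - \<delta>) / \<delta>)"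
  using sums_mult[OF geometric_sums[of "1 - \<delta>"], of "2 * norm g * (1 - \<delta>)"] delta
  by (simp add: mult.assoc)

lemma summable_iterates:
  assumes g: "g \<in> V"
  shows "summable (\<lambda>k. (L ^^ Suc k) (centre g))"
  by (rule summable_comparison_test[OF _ sums_summable[OF gap_geometric_sums[of g]]])
     (use norm_iterate_centre[OF g] in blast)

lemma corrector_sums: "g \<in> V \<Longrightarrow> (\<lambda>k. (L ^^ Suc k) (centre g)) sums corrector g"
  unfolding corrector_def by (rule summable_sums[OF summable_iterates])

lemma corrector_V: "g \<in> V \<Longrightarrow> corrector g \<in> V"
  by (rule V_sums[OF _ corrector_sums]) (rule iterate_centre)

lemma norm_corrector:
  assumes g: "g \<in> V"
  shows "norm (corrector g) \<le> 2 * norm g * (1 - \<delta>) / \<delta>"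
  unfolding corrector_def sums_unique[OF gap_geometric_sums[of g]]
  by (rule norm_suminf_le[OF norm_iterate_centre[OF g] sums_summable[OF gap_geometric_sums]])

lemma corrector_equation:
  assumes g: "g \<in> V"
  shows "corrector g = L (centre g) + L (corrector g)"
proof -
  have "(\<lambda>k. (L ^^ Suc (Suc k)) (centre g)) sums L (corrector g)"
    using bounded_linear.sums[OF L_linear corrector_sums[OF g]] by simp
  then have "(\<lambda>k. (L ^^ Suc k) (centre g)) sums (L (corrector g) + (L ^^ Suc 0) (centre g))"
    by (simp only: sums_Suc_iff[of "\<lambda>k. (L ^^ Suc k) (centre g)"])
  from sums_unique2[OF this corrector_sums[OF g]] show ?thesis by (simp add: algebra_simps)
qed

lemma M_tendsto:
  assumes "\<And>n. u n \<in> V" "u \<longlonglongrightarrow> y"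
  shows "(\<lambda>n. M (u n)) \<longlonglongrightarrow> M y"
proof -
  have y: "y \<in> V" using closed_sequentially[OF V_closed] assms by blast
  have "(\<lambda>n. norm (u n - y)) \<longlonglongrightarrow> 0" using assms(2) by (simp add: LIM_zero_iff tendsto_norm_zero)
  moreover have "norm (M (u n) - M y) \<le> norm (u n - y)" for n
    using M_le[of "u n - y"] M_diff[OF assms(1) y] V_diff[OF assms(1) y] by simp
  ultimately have "(\<lambda>n. M (u n) - M y) \<longlonglongrightarrow> 0"
    by (rule Lim_null_comparison[rotated, OF _ always_eventually, OF _ allI])
  then show ?thesis by (simp add: LIM_zero_iff)
qed

lemma M_sum: "(\<And>i. w i \<in> V) \<Longrightarrow> M (\<Sum>i<n. w i) = (\<Sum>i<(n::nat). M (w i))"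
proof (induction n)
  case 0
  show ?case using M_scale[OF V_one, of 0] by simp
qed (simp add: M_add V_sum)

lemma M_corrector:
  assumes g: "g \<in> V"
  shows "M (corrector g) = 0"
proof -
  have "(\<lambda>n. M (\<Sum>k<n. (L ^^ Suc k) (centre g))) \<longlonglongrightarrow> M (corrector g)"
    using corrector_sums[OF g] unfolding sums_def by (intro M_tendsto V_sum iterate_centre[OF g])
  moreover have "M (\<Sum>k<n. (L ^^ Suc k) (centre g)) = 0" for n
    using M_sum[of "\<lambda>k. (L ^^ Suc k) (centre g)" n] iterate_centre[OF g, of "Suc k" for k] by simp
  ultimately show ?thesis by (simp add: LIMSEQ_const_iff)
qed

definition gap_variance :: "'x \<Rightarrow> real" where
  "gap_variance g = M (g * g) - (M g)\<^sup>2 + 2 * (\<Sum>k. M (g * (L ^^ Suc k) (centre g)))"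

text \<open>
  The series of correlations sums to a single pairing, so the second-order expansion of a growth factor
  needs only the corrector.
\<close>

lemma gap_variance_corrector:
  assumes g: "g \<in> V"
  shows "gap_variance g = M (g * g) - (M g)\<^sup>2 + 2 * M (g * corrector g)"
proof -
  let ?w = "\<lambda>k. g * (L ^^ Suc k) (centre g)"
  have w: "?w k \<in> V" for k using g iterate_centre[OF g, of "Suc k"] by (blast intro: V_mult)
  have "?w sums (g * corrector g)" by (rule sums_mult[OF corrector_sums[OF g]])
  then have "(\<lambda>n. M (\<Sum>k<n. ?w k)) \<longlonglongrightarrow> M (g * corrector g)"
    unfolding sums_def by (intro M_tendsto V_sum w)
  then have "(\<lambda>k. M (?w k)) sums M (g * corrector g)"
    unfolding sums_def using M_sum[of ?w] w by simp
  then show ?thesis unfolding gap_variance_def by (simp only: sums_unique[symmetric])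
qed

end

section \<open>Iterates of the twisted operator\<close>

text \<open>
  The smallness condition makes the gap of \<open>L\<close> stronger than the perturbation of \<open>L\<close> to \<open>g \<mapsto> L (exp (t f) g)\<close>, so
  that the normalised iteration of the perturbed operator stays near the constant 1.
\<close>

locale small_twist = gap_subalgebra V M L \<delta>
  for V :: "'x :: {real_normed_algebra_1, banach} set" and M L \<delta> +
  fixes f :: 'x and t :: real
  assumes f_V: "f \<in> V"
    and small: "exp (\<bar>t\<bar> * norm f) - 1 \<le> \<delta>\<^sup>2 / (12 + 13 * \<delta>)"
begin

definition E :: 'x where "E = exp (t *\<^sub>R f) - 1"
definition s :: real where "s = \<bar>t\<bar> * norm f"
definition \<epsilon> :: real where "\<epsilon> = exp s - 1"
definition \<rho> :: real where "\<rho> = 2 * \<epsilon> / \<delta>"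
text \<open>
  This constant bounds the error in one step of the comparison of the normalised iteration with the corrector
  (\<open>renormalise_towards_corrector\<close>); its three terms come from replacing \<open>E\<close> by \<open>t f\<close>, from the product of \<open>E\<close> with the
  deviation, and from the normalisation.
\<close>

definition Q :: real where "Q = 2 * (exp s - 1 - s) + 2 * \<epsilon> * \<rho> + \<epsilon> * (1 + \<rho>) * \<rho>"

definition twist :: "'x \<Rightarrow> 'x" where "twist g = L (exp (t *\<^sub>R f) * g)"
definition factor :: "'x \<Rightarrow> real" where "factor g = M (exp (t *\<^sub>R f) * (1 + g))"
text \<open>
  If an iterate is a multiple of \<open>1 + g\<close> with \<open>M g = 0\<close>, the next one is a multiple of \<open>1 + renormalise g\<close>,
  and the multiple grows by \<open>factor g\<close>.
\<close>

definition renormalise :: "'x \<Rightarrow> 'x" where "renormalise g = twist (1 + g) /\<^sub>R factor g - 1"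
definition dev :: "nat \<Rightarrow> 'x" where "dev n = (renormalise ^^ n) 0"
definition admissible :: "'x \<Rightarrow> bool" where "admissible g \<longleftrightarrow> g \<in> V \<and> M g = 0 \<and> norm g \<le> \<rho>"

lemma s_nonneg: "0 \<le> s" and eps_nonneg: "0 \<le> \<epsilon>" and rho_nonneg: "0 \<le> \<rho>"
  using delta by (simp_all add: s_def \<epsilon>_def \<rho>_def)

lemma eps_small: "\<epsilon> \<le> \<delta>\<^sup>2 / (12 + 13 * \<delta>)"
  using small by (simp add: \<epsilon>_def s_def)

lemmas radius = perturbed_radius_invariant[OF delta eps_nonneg eps_small \<rho>_def]

lemma norm_tf: "norm (t *\<^sub>R f) = s" by (simp add: s_def)

lemma E_V: "E \<in> V" unfolding E_def using f_V by (intro V_intros)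

lemma norm_E: "norm E \<le> \<epsilon>" "norm (E - t *\<^sub>R f) \<le> exp s - 1 - s"
  "norm (E - t *\<^sub>R f - (t *\<^sub>R f)\<^sup>2 /\<^sub>R 2) \<le> exp s - 1 - s - s\<^sup>2 / 2"
  using norm_exp_remainders[of "t *\<^sub>R f"] unfolding norm_tf E_def \<epsilon>_def .

lemma M_mult_le: "g \<in> V \<Longrightarrow> h \<in> V \<Longrightarrow> \<bar>M (g * h)\<bar> \<le> norm g * norm h"
  using M_le[OF V_mult, of g h] norm_mult_ineq[of g h] by linarith

lemma factor_minus_1: "g \<in> V \<Longrightarrow> M g = 0 \<Longrightarrow> factor g - 1 = M (E * (1 + g))"
proof -
  assume g: "g \<in> V" "M g = 0"
  have "exp (t *\<^sub>R f) * (1 + g) = 1 + g + E * (1 + g)" by (simp add: E_def algebra_simps)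
  moreover have "M (1 + g) = 1" using g by (simp add: M_add M_one V_one)
  ultimately show ?thesis using g E_V by (simp add: factor_def M_add V_intros)
qed

lemma norm_one_plus: "admissible g \<Longrightarrow> norm (1 + g) \<le> 1 + \<rho>"
  using norm_triangle_ineq[of 1 g] by (simp add: admissible_def)

lemma norm_E_mult: "admissible g \<Longrightarrow> norm (E * (1 + g)) \<le> \<epsilon> * (1 + \<rho>)"
  using norm_mult_ineq[of E "1 + g"] mult_mono[OF norm_E(1) norm_one_plus] eps_nonneg
  by (smt (verit) norm_ge_zero)

lemma factor_near_1: "admissible g \<Longrightarrow> \<bar>factor g - 1\<bar> \<le> \<epsilon> * (1 + \<rho>)"
  using M_le[of "E * (1 + g)"] norm_E_mult[of g] factor_minus_1[of g] E_V
  unfolding admissible_def by (metis V_add V_mult V_one order_trans)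

lemma factor_pos: "admissible g \<Longrightarrow> factor g > 0"
  using factor_near_1[of g] radius(2) by linarith

text \<open>
  Subtracting the mean on both sides of \<open>factor g (1 + renormalise g) = L (exp (t f) (1 + g))\<close> leaves only
  centred terms, to which the gap applies. The new deviation is kept on the right-hand side: this avoids
  dividing by \<open>factor g\<close>, and its coefficient is small.
\<close>

lemma renormalise_equation:
  assumes g: "admissible g"
  shows "renormalise g = L g + L (centre (E * (1 + g))) - (factor g - 1) *\<^sub>R renormalise g"
proof -
  have gV: "g \<in> V" "M g = 0" using g by (auto simp: admissible_def)
  have "factor g *\<^sub>R (1 + renormalise g) = L (exp (t *\<^sub>R f) * (1 + g))"
    using factor_pos[OF g] by (simp add: renormalise_def twist_def)
  also have "exp (t *\<^sub>R f) * (1 + g) = 1 + g + E * (1 + g)" by (simp add: E_def algebra_simps)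
  also have "L \<dots> = 1 + L g + L (E * (1 + g))" by (simp add: L_simps L_one)
  also have "L (E * (1 + g)) = L (centre (E * (1 + g))) + (factor g - 1) *\<^sub>R 1"
    using factor_minus_1[OF gV] by (simp add: centre_def L_simps L_one)
  finally show ?thesis by (simp add: algebra_simps)
qed

lemma renormalise_admissible:
  assumes g: "admissible g"
  shows "admissible (renormalise g)"
proof -
  let ?h = "renormalise g"
  have gV: "g \<in> V" "M g = 0" "norm g \<le> \<rho>" using g by (auto simp: admissible_def)
  have tw: "twist (1 + g) \<in> V" unfolding twist_def using f_V gV by (intro V_intros)
  have "M (twist (1 + g)) = factor g"
    unfolding twist_def factor_def using f_V gV by (intro M_L V_intros)
  then have Mh: "M ?h = 0"
    using tw factor_pos[OF g] by (simp add: renormalise_def M_diff M_scale M_one V_intros)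
  have EV: "E * (1 + g) \<in> V" using E_V gV by (intro V_intros)
  have "norm ?h \<le> norm (L g) + norm (L (centre (E * (1 + g)))) + norm ((factor g - 1) *\<^sub>R ?h)"
    using norm_triangle_ineq[of "L g" "L (centre (E * (1 + g)))"]
      norm_triangle_ineq4[of "L g + L (centre (E * (1 + g)))" "(factor g - 1) *\<^sub>R ?h"]
      renormalise_equation[OF g] by (smt (verit))
  also have "\<dots> \<le> (1 - \<delta>) * \<rho> + 2 * (1 - \<delta>) * (\<epsilon> * (1 + \<rho>)) + \<epsilon> * (1 + \<rho>) * norm ?h"
  proof (intro add_mono)
    show "norm (L g) \<le> (1 - \<delta>) * \<rho>"
      using L_contracts[OF gV(1,2)] mult_left_mono[OF gV(3), of "1 - \<delta>"] delta by simp
    show "norm (L (centre (E * (1 + g)))) \<le> 2 * (1 - \<delta>) * (\<epsilon> * (1 + \<rho>))"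
      using norm_L_centre[OF EV] mult_left_mono[OF norm_E_mult[OF g], of "2 * (1 - \<delta>)"] delta by simp
    show "norm ((factor g - 1) *\<^sub>R ?h) \<le> \<epsilon> * (1 + \<rho>) * norm ?h"
      using factor_near_1[OF g] by (simp add: mult_right_mono)
  qed
  \<comment> \<open>The normalisation term is absorbed into the left-hand side.\<close>
  finally have "(1 - \<epsilon> * (1 + \<rho>)) * norm ?h \<le> (1 - \<epsilon> * (1 + \<rho>)) * \<rho>"
    using radius(3) by (simp add: left_diff_distrib)
  then have "norm ?h \<le> \<rho>" by (rule mult_left_le_imp_le) (use radius(2) in simp)
  with Mh tw show ?thesis by (simp add: admissible_def renormalise_def V_intros)
qed

lemma dev_admissible: "admissible (dev n)"
proof (induction n)
  case 0
  show ?case using M_scale[OF V_one, of 0] subspace_0[OF V_subspace] rho_nonneg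
    by (simp add: dev_def admissible_def)
qed (auto simp: dev_def intro: renormalise_admissible)

lemma twist_iterate: "(twist ^^ n) 1 = (\<Prod>k<n. factor (dev k)) *\<^sub>R (1 + dev n)"
proof (induction n)
  case 0
  show ?case by (simp add: dev_def)
next
  case (Suc n)
  have scale: "twist (r *\<^sub>R g) = r *\<^sub>R twist g" for r g
    by (simp add: twist_def L_simps)
  have "twist (1 + dev n) = factor (dev n) *\<^sub>R (1 + dev (Suc n))"
    using factor_pos[OF dev_admissible[of n]] by (simp add: dev_def renormalise_def)
  then show ?case by (simp add: Suc scale)
qed

text \<open>
  The point \<open>t \<psi>\<close>, with \<open>\<psi>\<close> the corrector of \<open>f\<close>, is fixed by the affine map \<open>g \<mapsto> L g + L (centre (t f))\<close>, which
  is the linearisation of the normalised iteration at the origin. So the distance to \<open>t \<psi>\<close> contracts, up to an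
  error of second order.
\<close>

lemma renormalise_towards_corrector:
  assumes g: "admissible g"
  shows "norm (renormalise g - t *\<^sub>R corrector f) \<le> (1 - \<delta>) * norm (g - t *\<^sub>R corrector f) + Q"
proof -
  let ?S = "t *\<^sub>R corrector f" and ?h = "renormalise g"
  have gV: "g \<in> V" "M g = 0" "norm g \<le> \<rho>" using g by (auto simp: admissible_def)
  have S: "?S \<in> V" "M ?S = 0" using corrector_V[OF f_V] M_corrector[OF f_V] by (auto intro: V_scale simp: M_scale)
  have tf: "t *\<^sub>R f \<in> V" using f_V by (rule V_scale)
  have S_eq: "?S = L (centre (t *\<^sub>R f)) + L ?S"
  proof -
    have "centre (t *\<^sub>R f) = t *\<^sub>R centre f" by (simp add: centre_def M_scale[OF f_V] scaleR_diff_right)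
    then have "t *\<^sub>R (L (centre f) + L (corrector f)) = L (centre (t *\<^sub>R f)) + L ?S"
      by (simp add: L_simps scaleR_add_right)
    then show ?thesis using corrector_equation[OF f_V] by simp
  qed
  have split: "centre (E * (1 + g)) - centre (t *\<^sub>R f) = centre (E - t *\<^sub>R f) + centre (E * g)"
    using E_V gV tf by (simp add: centre_def M_add M_diff V_intros algebra_simps)
  have "?h - ?S = L (g - ?S) + L (centre (E - t *\<^sub>R f)) + L (centre (E * g)) - (factor g - 1) *\<^sub>R ?h"
  proof -
    have "?h - ?S = (L g + L (centre (E * (1 + g))) - (factor g - 1) *\<^sub>R ?h) - (L (centre (t *\<^sub>R f)) + L ?S)"
      by (rule arg_cong2[OF renormalise_equation[OF g] S_eq])
    also have "\<dots> = L (g - ?S) + L (centre (E * (1 + g)) - centre (t *\<^sub>R f)) - (factor g - 1) *\<^sub>R ?h"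
      by (simp add: L_simps)
    finally show ?thesis unfolding split by (simp add: L_simps add.assoc)
  qed
  also have "norm \<dots> \<le> norm (L (g - ?S)) + norm (L (centre (E - t *\<^sub>R f))) + norm (L (centre (E * g)))
      + norm ((factor g - 1) *\<^sub>R ?h)"
    by (intro norm_triangle_le_diff add_right_mono norm_triangle_le order_refl)
  also have "\<dots> \<le> (1 - \<delta>) * norm (g - ?S) + 2 * (exp s - 1 - s) + 2 * \<epsilon> * \<rho> + \<epsilon> * (1 + \<rho>) * \<rho>"
  proof (intro add_mono)
    have two: "norm (L (centre y)) \<le> 2 * norm y" if "y \<in> V" for y
      using norm_L_centre[OF that] mult_right_mono[of "2 * (1 - \<delta>)" 2 "norm y"] delta by simp
    show "norm (L (g - ?S)) \<le> (1 - \<delta>) * norm (g - ?S)"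
      using gV S by (intro L_contracts) (auto simp: M_diff V_intros)
    show "norm (L (centre (E - t *\<^sub>R f))) \<le> 2 * (exp s - 1 - s)"
      using two[of "E - t *\<^sub>R f"] norm_E(2) E_V tf by (simp add: V_intros)
    show "norm (L (centre (E * g))) \<le> 2 * \<epsilon> * \<rho>"
    proof -
      have "norm (E * g) \<le> \<epsilon> * \<rho>"
        using norm_mult_ineq[of E g] mult_mono[OF norm_E(1) gV(3) eps_nonneg] by simp
      then show ?thesis using two[of "E * g"] E_V gV by (simp add: V_intros)
    qed
    show "norm ((factor g - 1) *\<^sub>R ?h) \<le> \<epsilon> * (1 + \<rho>) * \<rho>"
      using mult_mono[OF factor_near_1[OF g], of "norm ?h" \<rho>] renormalise_admissible[OF g]
        eps_nonneg rho_nonneg by (simp add: admissible_def)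
  qed
  finally show ?thesis unfolding Q_def by simp
qed

lemma norm_scaled_corrector: "norm (t *\<^sub>R corrector f) \<le> 2 * s * (1 - \<delta>) / \<delta>"
  using mult_left_mono[OF norm_corrector[OF f_V], of "\<bar>t\<bar>"] by (simp add: s_def mult_ac)

text \<open>
  The two terms are the transient, from the start at deviation 0, and the accumulated error, since \<open>Q / \<delta>\<close> is the
  fixed point of \<open>d \<mapsto> (1 - \<delta>) d + Q\<close>.
\<close>

lemma dev_near_corrector: "norm (dev n - t *\<^sub>R corrector f) \<le> (1 - \<delta>) ^ n * (2 * s / \<delta>) + Q / \<delta>"
proof (induction n)
  case 0
  have "2 * s * (1 - \<delta>) / \<delta> \<le> 2 * s / \<delta>"
    using delta s_nonneg mult_left_mono[of "1 - \<delta>" 1 "2 * s"] by (intro divide_right_mono) auto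
  moreover have "0 \<le> exp s - 1 - s" using exp_ge_add_one_self[of s] by linarith
  then have "0 \<le> Q / \<delta>" using eps_nonneg rho_nonneg delta by (simp add: Q_def)
  ultimately show ?case using norm_scaled_corrector by (simp add: dev_def)
next
  case (Suc n)
  have "norm (dev (Suc n) - t *\<^sub>R corrector f) \<le> (1 - \<delta>) * norm (dev n - t *\<^sub>R corrector f) + Q"
    using renormalise_towards_corrector[OF dev_admissible[of n]] by (simp add: dev_def)
  also have "\<dots> \<le> (1 - \<delta>) * ((1 - \<delta>) ^ n * (2 * s / \<delta>) + Q / \<delta>) + Q"
    using Suc delta by (intro add_right_mono mult_left_mono) auto
  also have "\<dots> = (1 - \<delta>) ^ Suc n * (2 * s / \<delta>) + Q / \<delta>" using delta by (simp add: field_simps)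
  finally show ?case .
qed

definition log_rate :: real where
  "log_rate = t * M f + t\<^sup>2 / 2 * gap_variance f + 10 * (1 + 1 / \<delta>)\<^sup>2 * s ^ 3"

definition transient :: "nat \<Rightarrow> real" where
  "transient n = 2 * s\<^sup>2 / \<delta> * (1 - \<delta>) ^ n"

text \<open>
  The growth factor is \<open>1 + M E + M (E g)\<close> with \<open>E = exp (t f) - 1\<close>. The first mean is expanded to second order
  in \<open>t f\<close>. In the second, \<open>E g\<close> is replaced by \<open>t f * t \<psi>\<close>; this supplies the correlation part of the variance, and the
  replacement errors are those of \<open>growth_factor_le_exp\<close>.
\<close>

lemma factor_dev_le: "factor (dev n) \<le> exp (log_rate + 2 * transient n)"
proof -
  let ?g = "dev n" and ?S = "t *\<^sub>R corrector f"
  define w v where "w = t * M f" and "v = t\<^sup>2 / 2 * gap_variance f"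
  have g: "?g \<in> V" "M ?g = 0" "norm ?g \<le> \<rho>" using dev_admissible[of n] by (auto simp: admissible_def)
  have S: "?S \<in> V" using corrector_V[OF f_V] by (rule V_scale)
  have tf: "t *\<^sub>R f \<in> V" using f_V by (rule V_scale)
  have ts: "\<bar>M (t *\<^sub>R f * h)\<bar> \<le> s * norm h" if "h \<in> V" for h
    using M_mult_le[OF tf that] by (simp only: norm_tf)
  \<comment> \<open>The subtracted pairing with the corrector is returned by the mean of E g below.\<close>
  have t2: "t\<^sup>2 / 2 * M (f * f) = w\<^sup>2 / 2 + v - M (t *\<^sub>R f * ?S)"
    using f_V corrector_V[OF f_V] unfolding v_def w_def gap_variance_corrector[OF f_V]
    by (simp add: M_scale V_mult power2_eq_square algebra_simps)
  have sq: "M ((t *\<^sub>R f)\<^sup>2 /\<^sub>R 2) = t\<^sup>2 / 2 * M (f * f)"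
    using f_V by (simp add: M_scale V_mult V_scale power2_eq_square)
  have "M E = M (t *\<^sub>R f) + M ((t *\<^sub>R f)\<^sup>2 /\<^sub>R 2) + M (E - t *\<^sub>R f - (t *\<^sub>R f)\<^sup>2 /\<^sub>R 2)"
    using M_diff[OF V_diff[OF E_V tf] V_scale[OF V_power[OF tf], of "inverse 2" 2]] M_diff[OF E_V tf] by linarith
  moreover have "M (E - t *\<^sub>R f - (t *\<^sub>R f)\<^sup>2 /\<^sub>R 2) \<le> exp s - 1 - s - s\<^sup>2 / 2"
    using M_le[of "E - t *\<^sub>R f - (t *\<^sub>R f)\<^sup>2 /\<^sub>R 2"] norm_E(3) E_V tf
    by (smt (verit) V_diff V_scale V_power)
  ultimately have ME: "M E \<le> w + (w\<^sup>2 / 2 + v - M (t *\<^sub>R f * ?S)) + (exp s - 1 - s - s\<^sup>2 / 2)"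
    unfolding sq t2 by (simp add: w_def M_scale[OF f_V])
  have "E * ?g = t *\<^sub>R f * ?S + t *\<^sub>R f * (?g - ?S) + (E - t *\<^sub>R f) * ?g"
    by (simp add: algebra_simps)
  then have "M (E * ?g) = M (t *\<^sub>R f * ?S) + M (t *\<^sub>R f * (?g - ?S)) + M ((E - t *\<^sub>R f) * ?g)"
    using E_V tf S g by (simp only: M_add V_intros)
  moreover have "M (t *\<^sub>R f * (?g - ?S)) \<le> s * ((1 - \<delta>) ^ n * (2 * s / \<delta>) + Q / \<delta>)"
    using ts[OF V_diff[OF g(1) S]] mult_left_mono[OF dev_near_corrector[of n] s_nonneg] by linarith
  moreover have "s * ((1 - \<delta>) ^ n * (2 * s / \<delta>) + Q / \<delta>) = transient n + s * (Q / \<delta>)"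
    by (simp add: transient_def power2_eq_square algebra_simps)
  moreover have "M ((E - t *\<^sub>R f) * ?g) \<le> (exp s - 1 - s) * \<rho>"
    using M_mult_le[OF V_diff[OF E_V tf] g(1)] mult_mono[OF norm_E(2) g(3)] norm_ge_zero
    by (smt (verit) norm_E(2))
  ultimately have MEg: "M (E * ?g) \<le> M (t *\<^sub>R f * ?S) + (transient n + s * (Q / \<delta>)) + (exp s - 1 - s) * \<rho>"
    by linarith
  have "factor ?g = 1 + M E + M (E * ?g)"
    using factor_minus_1[OF g(1,2)] E_V g by (simp add: distrib_left M_add V_intros)
  with ME MEg have "factor ?g \<le> 1 + w + w\<^sup>2 / 2 + v + (exp s - 1 - s - s\<^sup>2 / 2) + s * (Q / \<delta>)
      + (exp s - 1 - s) * \<rho> + transient n" by linarith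
  also have "\<dots> \<le> exp (w + v + 10 * (1 + 1 / \<delta>)\<^sup>2 * s ^ 3 + 2 * transient n)"
  proof (rule growth_factor_le_exp[OF delta s_nonneg \<epsilon>_def eps_small \<rho>_def Q_def])
    show w: "\<bar>w\<bar> \<le> s"
      using mult_left_mono[OF M_le[OF f_V], of "\<bar>t\<bar>"] by (simp add: w_def s_def abs_mult)
    have "\<bar>w\<^sup>2\<bar> \<le> s\<^sup>2" using power_mono[OF w, of 2] by simp
    moreover have "\<bar>t\<^sup>2 * M (f * f)\<bar> \<le> s\<^sup>2"
      using mult_left_mono[OF M_mult_le[OF f_V f_V], of "t\<^sup>2"]
      by (simp add: abs_mult s_def power2_eq_square mult_ac)
    moreover have "\<bar>M (t *\<^sub>R f * ?S)\<bar> \<le> 2 * s\<^sup>2 / \<delta> - 2 * s\<^sup>2"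
    proof -
      have "\<bar>M (t *\<^sub>R f * ?S)\<bar> \<le> s * (2 * s * (1 - \<delta>) / \<delta>)"
        using ts[OF S] mult_left_mono[OF norm_scaled_corrector s_nonneg] by linarith
      also have "\<dots> = 2 * s\<^sup>2 / \<delta> - 2 * s\<^sup>2" using delta by (simp add: field_simps power2_eq_square)
      finally show ?thesis .
    qed
    moreover have "t\<^sup>2 / 2 * M (f * f) = t\<^sup>2 * M (f * f) / 2" by simp
    moreover have "0 \<le> s\<^sup>2" "0 \<le> w\<^sup>2" by simp_all
    ultimately show "\<bar>v\<bar> \<le> 2 * s\<^sup>2 / \<delta>" using t2 by linarith
    show "0 \<le> transient n" using delta by (simp add: transient_def)
  qed
  finally show ?thesis by (simp add: log_rate_def w_def v_def)
qed

lemma sum_transient_le: "(\<Sum>k<n. transient k) \<le> 2 / 625"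
proof -
  have "s \<le> \<delta> / 25"
    using small_exp_imp(1)[OF delta eps_small] exp_ge_add_one_self[of s] unfolding \<epsilon>_def by linarith
  then have "s\<^sup>2 \<le> (\<delta> / 25)\<^sup>2" using s_nonneg by (rule power_mono)
  have "(\<Sum>k<n. (1 - \<delta>) ^ k) \<le> 1 / \<delta>"
    using delta sum_gp_strict[of "1 - \<delta>" n] by (simp add: divide_right_mono)
  then have "(\<Sum>k<n. transient k) \<le> 2 * s\<^sup>2 / \<delta> * (1 / \<delta>)"
    unfolding transient_def sum_distrib_left[symmetric] using delta by (intro mult_left_mono) auto
  also have "\<dots> \<le> 2 * (\<delta> / 25)\<^sup>2 / \<delta> * (1 / \<delta>)"
    using \<open>s\<^sup>2 \<le> _\<close> delta by (intro mult_right_mono divide_right_mono) auto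
  also have "\<dots> = 2 / 625" using delta by (simp add: power2_eq_square)
  finally show ?thesis .
qed

text \<open>
  The product of the growth factors gives the exponential; the constant is made of the radius, at most \<open>1 + 2/25\<close>,
  and of the accumulated transients, which contribute at most \<open>exp (4/625)\<close>.
\<close>

theorem norm_twist_iterate_le: "norm ((twist ^^ n) 1) \<le> 1.3185 * exp (real n * log_rate)"
proof -
  have "(\<Prod>k<n. factor (dev k)) \<le> (\<Prod>k<n. exp (log_rate + 2 * transient k))"
    using factor_dev_le factor_pos[OF dev_admissible] by (intro prod_mono) (auto intro: less_imp_le)
  also have "\<dots> = exp (real n * log_rate + 2 * (\<Sum>k<n. transient k))"
    by (simp add: exp_sum[symmetric] sum.distrib sum_distrib_left)
  also have "\<dots> \<le> exp (real n * log_rate) * exp (4 / 625)"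
    unfolding exp_add[symmetric] using sum_transient_le[of n] by simp
  also have "\<dots> \<le> exp (real n * log_rate) * 1.2"
    using exp_bound[of "4 / 625"] by (intro mult_left_mono) (auto simp: power2_eq_square)
  finally have prod: "(\<Prod>k<n. factor (dev k)) \<le> exp (real n * log_rate) * 1.2" .
  have pos: "0 \<le> (\<Prod>k<n. factor (dev k))"
    using factor_pos[OF dev_admissible] by (intro prod_nonneg) (auto intro: less_imp_le)
  have "norm ((twist ^^ n) 1) = (\<Prod>k<n. factor (dev k)) * norm (1 + dev n)"
    using pos by (simp add: twist_iterate)
  also have "\<dots> \<le> (exp (real n * log_rate) * 1.2) * (1 + 2 / 25)"
    using norm_one_plus[OF dev_admissible[of n]] radius(1) prod pos by (intro mult_mono) auto
  also have "\<dots> \<le> 1.3185 * exp (real n * log_rate)" by simp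
  finally show ?thesis .
qed

end

section \<open>Exponential moments of a Markov chain\<close>

lemma kernel_prob_space:
  assumes "m \<in> borel \<rightarrow>\<^sub>M prob_algebra borel"
  shows "prob_space (m x)" "sets (m x) = sets borel"
  using measurable_space[OF assms, of x] by (auto simp: space_prob_algebra)

lemma space_past [simp]: "space (past P X k) = space P"
  by (simp add: past_def space_measure_of_conv)

lemma past_generators:
  "{X i -` A \<inter> space P | i A. i \<le> k \<and> A \<in> sets borel} \<subseteq> Pow (space P)"
  by auto

lemma subalgebra_past:
  assumes "\<And>i. X i \<in> P \<rightarrow>\<^sub>M borel"
  shows "subalgebra P (past P X k)"
proof -
  have "sigma_sets (space P) {X i -` A \<inter> space P | i A. i \<le> k \<and> A \<in> sets borel} \<subseteq> sets P"
    by (rule sets.sigma_sets_subset) (use assms in \<open>auto intro: measurable_sets\<close>)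
  then show ?thesis
    unfolding subalgebra_def space_past by (simp add: past_def sets_measure_of[OF past_generators])
qed

lemma measurable_past: "i \<le> k \<Longrightarrow> X i \<in> past P X k \<rightarrow>\<^sub>M borel"
  unfolding measurable_def space_past
  by (auto simp: past_def sets_measure_of[OF past_generators] intro!: sigma_sets.Basic)

text \<open>
  The Markov property is given for indicators of Borel sets only. Weighting the probability measure by the density \<open>Y\<close>
  turns it into an identity between two measures on the state space, the weighted law of the next
  state and the image of the weighted law of the present state under the kernel; integrating \<open>g\<close> against both
  gives the claim for all nonnegative \<open>g\<close> at once.
\<close>

lemma markov_chain_step:
  fixes X :: "nat \<Rightarrow> 'w \<Rightarrow> 'a :: polish_space" and Y :: "'w \<Rightarrow> real"
  assumes mc: "markov_chain P m \<mu> X" and kernel: "m \<in> borel \<rightarrow>\<^sub>M prob_algebra borel"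
    and Y: "Y \<in> borel_measurable (past P X k)" "\<And>w. 0 \<le> Y w" "\<And>w. Y w \<le> B"
    and g: "g \<in> borel_measurable borel"
  shows "(\<integral>\<^sup>+w. ennreal (Y w) * g (X (Suc k) w) \<partial>P) = (\<integral>\<^sup>+w. ennreal (Y w) * (\<integral>\<^sup>+y. g y \<partial>m (X k w)) \<partial>P)"
proof -
  interpret prob_space P using mc by (simp add: markov_chain_def)
  have X [measurable]: "X i \<in> P \<rightarrow>\<^sub>M borel" for i using mc by (simp add: markov_chain_def)
  have sub: "subalgebra P (past P X k)" by (rule subalgebra_past[OF X])
  interpret finite_measure_subalgebra P "past P X k" by unfold_locales (rule sub)
  have YP [measurable]: "Y \<in> borel_measurable P" by (rule measurable_from_subalg[OF sub Y(1)])
  have sk: "m \<in> borel \<rightarrow>\<^sub>M subprob_algebra borel" by (rule measurable_prob_algebraD[OF kernel])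
  note [measurable] = sk g
  define D where "D = density P (\<lambda>w. ennreal (Y w))"
  have D [simp, measurable_cong]: "sets D = sets P" "space D = space P" by (simp_all add: D_def)
  have XD [measurable]: "X i \<in> D \<rightarrow>\<^sub>M borel" for i
    using X[of i] by (simp add: measurable_cong_sets[OF D(1) refl])
  have mD: "m \<in> distr D borel (X k) \<rightarrow>\<^sub>M subprob_algebra borel" using sk by simp
  have laws: "distr D borel (X (Suc k)) = distr D borel (X k) \<bind> m"
  proof (rule measure_eqI)
    show "sets (distr D borel (X (Suc k))) = sets (distr D borel (X k) \<bind> m)"
      by (simp add: sets_bind[OF kernel_prob_space(2)[OF kernel]])
    fix A assume "A \<in> sets (distr D borel (X (Suc k)))"
    then have A [measurable]: "A \<in> sets borel" by simp
    have "emeasure (distr D borel (X (Suc k))) A = (\<integral>\<^sup>+x. indicator A x \<partial>distr D borel (X (Suc k)))"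
      by (rule nn_integral_indicator[symmetric]) simp
    also have "\<dots> = (\<integral>\<^sup>+w. indicator A (X (Suc k) w) \<partial>D)"
      by (rule nn_integral_distr[OF XD]) simp
    also have "\<dots> = (\<integral>\<^sup>+w. ennreal (Y w * indicator A (X (Suc k) w)) \<partial>P)"
      unfolding D_def by (subst nn_integral_density) (auto simp: ennreal_mult' Y(2) ennreal_indicator)
    also have "\<dots> = ennreal (\<integral>w. Y w * indicator A (X (Suc k) w) \<partial>P)"
      by (intro nn_integral_eq_integral integrable_const_bound[of _ "B"] AE_I2)
         (auto simp: Y split: split_indicator intro: order_trans[OF Y(2) Y(3)])
    also have "(\<integral>w. Y w * indicator A (X (Suc k) w) \<partial>P)
        = (\<integral>w. Y w * real_cond_exp P (past P X k) (\<lambda>w. indicator A (X (Suc k) w)) w \<partial>P)"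
    proof (rule real_cond_exp_intg(2)[symmetric])
      show "integrable P (\<lambda>w. Y w * indicator A (X (Suc k) w))"
        by (intro integrable_const_bound[of _ "B"] AE_I2)
           (auto simp: Y split: split_indicator intro: order_trans[OF Y(2) Y(3)])
    qed (use Y in auto)
    also have "\<dots> = (\<integral>w. Y w * measure (m (X k w)) A \<partial>P)"
    proof (rule integral_cong_AE)
      show "AE w in P. Y w * real_cond_exp P (past P X k) (\<lambda>w. indicator A (X (Suc k) w)) w
          = Y w * measure (m (X k w)) A"
        using mc A unfolding markov_chain_def by (auto elim!: allE[of _ k])
    qed measurable
    also have "ennreal \<dots> = (\<integral>\<^sup>+w. ennreal (Y w * measure (m (X k w)) A) \<partial>P)"
    proof (intro nn_integral_eq_integral[symmetric] integrable_const_bound[of _ "B"] AE_I2)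
      fix w
      interpret m: prob_space "m (X k w)" by (rule kernel_prob_space[OF kernel])
      have "Y w * measure (m (X k w)) A \<le> B * 1"
        using order_trans[OF Y(2) Y(3)] Y by (intro mult_mono) auto
      then show "norm (Y w * measure (m (X k w)) A) \<le> B" using Y(2) by simp
    qed (use Y(2) in auto)
    also have "\<dots> = (\<integral>\<^sup>+w. emeasure (m (X k w)) A \<partial>D)"
    proof -
      have "emeasure (m x) A = ennreal (measure (m x) A)" for x
      proof -
        interpret m: prob_space "m x" by (rule kernel_prob_space[OF kernel])
        show ?thesis by (rule m.emeasure_eq_measure)
      qed
      then show ?thesis unfolding D_def by (subst nn_integral_density) (auto simp: ennreal_mult' Y(2))
    qed
    also have "\<dots> = (\<integral>\<^sup>+x. emeasure (m x) A \<partial>distr D borel (X k))"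
      by (subst nn_integral_distr) auto
    also have "\<dots> = emeasure (distr D borel (X k) \<bind> m) A"
      by (rule emeasure_bind[symmetric, OF _ mD A]) simp
    finally show "emeasure (distr D borel (X (Suc k))) A = emeasure (distr D borel (X k) \<bind> m) A" .
  qed
  have "(\<integral>\<^sup>+w. ennreal (Y w) * g (X (Suc k) w) \<partial>P) = (\<integral>\<^sup>+y. g y \<partial>distr D borel (X (Suc k)))"
    unfolding D_def by (subst nn_integral_distr) (auto simp: nn_integral_density)
  also have "\<dots> = (\<integral>\<^sup>+x. \<integral>\<^sup>+y. g y \<partial>m x \<partial>distr D borel (X k))"
    unfolding laws by (rule nn_integral_bind[OF g mD])
  also have "\<dots> = (\<integral>\<^sup>+w. ennreal (Y w) * (\<integral>\<^sup>+y. g y \<partial>m (X k w)) \<partial>P)"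
    unfolding D_def by (subst nn_integral_distr) (auto simp: nn_integral_density)
  finally show ?thesis .
qed

text \<open>
  For nonnegative integrands the recursion makes sense without integrability, so exponential moments are first
  computed in the extended reals.
\<close>

primrec exp_moment :: "('a \<Rightarrow> 'a measure) \<Rightarrow> ('a \<Rightarrow> real) \<Rightarrow> nat \<Rightarrow> 'a \<Rightarrow> ennreal" where
  "exp_moment m \<psi> 0 = (\<lambda>x. 1)"
| "exp_moment m \<psi> (Suc j) = (\<lambda>x. \<integral>\<^sup>+y. ennreal (exp (\<psi> y)) * exp_moment m \<psi> j y \<partial>m x)"

lemma exp_moment_measurable:
  assumes "m \<in> borel \<rightarrow>\<^sub>M prob_algebra borel" and [measurable]: "\<psi> \<in> borel_measurable borel"
  shows "exp_moment m \<psi> j \<in> borel_measurable borel"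
proof (induction j)
  case (Suc j)
  note [measurable] = Suc measurable_prob_algebraD[OF assms(1)]
  show ?case by simp
qed simp

text \<open>
  Each use of the Markov property moves one step of the chain from the exponential into the function evaluated at
  the last visible state; the claim for \<open>k = 0\<close> is the one of interest, the general \<open>k\<close> carries the induction.
\<close>

lemma nn_integral_exp_sum:
  fixes X :: "nat \<Rightarrow> 'w \<Rightarrow> 'a :: polish_space"
  assumes mc: "markov_chain P m \<mu> X" and kernel: "m \<in> borel \<rightarrow>\<^sub>M prob_algebra borel"
    and \<psi>: "\<psi> \<in> borel_measurable borel" "\<And>x. \<bar>\<psi> x\<bar> \<le> B"
  shows "(\<integral>\<^sup>+w. ennreal (exp (\<Sum>i=1..k + j. \<psi> (X i w))) \<partial>P)
       = (\<integral>\<^sup>+w. ennreal (exp (\<Sum>i=1..k. \<psi> (X i w))) * exp_moment m \<psi> j (X k w) \<partial>P)"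
proof (induction j arbitrary: k)
  case (Suc j)
  note [measurable] = \<psi>(1) exp_moment_measurable[OF kernel \<psi>(1)]
  let ?Y = "\<lambda>w. exp (\<Sum>i=1..k. \<psi> (X i w))"
  let ?g = "\<lambda>y. ennreal (exp (\<psi> y)) * exp_moment m \<psi> j y"
  have "(\<integral>\<^sup>+w. ennreal (exp (\<Sum>i=1..k + Suc j. \<psi> (X i w))) \<partial>P)
      = (\<integral>\<^sup>+w. ennreal (exp (\<Sum>i=1..Suc k. \<psi> (X i w))) * exp_moment m \<psi> j (X (Suc k) w) \<partial>P)"
    using Suc[of "Suc k"] by simp
  also have "\<dots> = (\<integral>\<^sup>+w. ennreal (?Y w) * ?g (X (Suc k) w) \<partial>P)"
    by (simp add: exp_add ennreal_mult mult.assoc)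
  also have "\<dots> = (\<integral>\<^sup>+w. ennreal (?Y w) * (\<integral>\<^sup>+y. ?g y \<partial>m (X k w)) \<partial>P)"
  proof (rule markov_chain_step[OF mc kernel, where B = "exp (\<Sum>i=1..k. B)"])
    have "(\<lambda>w. \<psi> (X i w)) \<in> borel_measurable (past P X k)" if "i \<in> {1..k}" for i
      using measurable_compose[OF measurable_past[of i k X P] \<psi>(1)] that by simp
    then show "?Y \<in> borel_measurable (past P X k)" by (intro measurable_compose[OF _ borel_measurable_exp] borel_measurable_sum)
    show "?Y w \<le> exp (\<Sum>i=1..k. B)" for w
      unfolding exp_le_cancel_iff using \<psi>(2) by (intro sum_mono) (auto simp: abs_le_iff)
  qed auto
  finally show ?case by simp
qed simp

section \<open>Real-valued elements of the function algebra\<close>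

context contracting_kernel
begin

text \<open>
  The real number behind the scalar \<open>ev g x\<close>, where there is one. The shift by \<open>norm g\<close> makes that number
  nonnegative, so that the norm recovers it. Written in this way, \<open>val\<close> is visibly measurable in \<open>x\<close> and continuous in \<open>g\<close>,
  whatever the scalar field.
\<close>

definition val :: "'x \<Rightarrow> 'a \<Rightarrow> real" where
  "val g x = norm (ev g x + of_real (norm g)) - norm g"

definition real_elements :: "'x set" where
  "real_elements = {g. \<forall>x. ev g x = of_real (val g x)}"

definition mean :: "'x \<Rightarrow> real" where
  "mean g = (\<integral>x. val g x \<partial>\<mu>0)"

lemma val_eqI:
  assumes g: "ev g = (\<lambda>x. of_real (\<psi> x))"
  shows "val g = \<psi>" "g \<in> real_elements"
proof -
  show "val g = \<psi>"
  proof
    fix x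
    have "\<bar>\<psi> x\<bar> \<le> norm g" using norm_ev_le[of g x] by (simp add: g)
    moreover have "ev g x + of_real (norm g) = of_real (\<psi> x + norm g)" by (simp add: g)
    ultimately show "val g x = \<psi> x" unfolding val_def by (simp only: norm_of_real)
  qed
  with g show "g \<in> real_elements" by (simp add: real_elements_def)
qed

lemma ev_val: "g \<in> real_elements \<Longrightarrow> ev g = (\<lambda>x. of_real (val g x))"
  by (auto simp: real_elements_def)

lemma val_bounded: "\<bar>val g x\<bar> \<le> norm g"
  using norm_ev_le[of g x] norm_triangle_ineq[of "ev g x" "of_real (norm g)"]
    norm_diff_ineq[of "of_real (norm g) :: 'k" "ev g x"]
  by (simp add: val_def add.commute)

lemma val_measurable [measurable]: "val g \<in> borel_measurable borel"
  unfolding val_def using ev_measurable[of g] by measurable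

lemma
  assumes "g \<in> real_elements" "h \<in> real_elements"
  shows val_add: "val (g + h) = (\<lambda>x. val g x + val h x)" and real_add: "g + h \<in> real_elements"
    and val_mult: "val (g * h) = (\<lambda>x. val g x * val h x)" and real_mult: "g * h \<in> real_elements"
proof -
  have "ev (g + h) = (\<lambda>x. of_real (val g x + val h x))" "ev (g * h) = (\<lambda>x. of_real (val g x * val h x))"
    by (simp_all add: ev_add ev_mult ev_val[OF assms(1)] ev_val[OF assms(2)])
  from val_eqI[OF this(1)] val_eqI[OF this(2)]
  show "val (g + h) = (\<lambda>x. val g x + val h x)" "g + h \<in> real_elements"
    "val (g * h) = (\<lambda>x. val g x * val h x)" "g * h \<in> real_elements" by auto
qed

lemma
  assumes "g \<in> real_elements"
  shows val_scaleR: "val (r *\<^sub>R g) = (\<lambda>x. r * val g x)" and real_scaleR: "r *\<^sub>R g \<in> real_elements"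
proof -
  have "ev (r *\<^sub>R g) = (\<lambda>x. of_real (r * val g x))"
    unfolding ev_scaleR ev_val[OF assms] by (simp add: scaleR_conv_of_real)
  from val_eqI[OF this] show "val (r *\<^sub>R g) = (\<lambda>x. r * val g x)" "r *\<^sub>R g \<in> real_elements" by auto
qed

lemma val_one: "val 1 = (\<lambda>x. 1)" and real_one: "1 \<in> real_elements"
  using val_eqI[of 1 "\<lambda>_. 1"] by (simp_all add: ev_one)

lemma real_zero: "0 \<in> real_elements"
  using real_scaleR[OF real_one, of 0] by simp

lemma ev_bounded_linear: "bounded_linear (\<lambda>g. ev g x)"
  by (rule bounded_linear_intro[where K = 1]) (auto simp: ev_add ev_scaleR norm_ev_le)

text \<open>
  Membership equates two continuous functions of \<open>g\<close> at each point.
\<close>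

lemma closed_real_elements: "closed real_elements"
proof -
  have [continuous_intros]: "continuous_on UNIV (\<lambda>g. ev g x)" for x
    by (rule linear_continuous_on[OF ev_bounded_linear])
  have "closed {g. ev g x = of_real (val g x)}" for x
    unfolding val_def by (intro closed_Collect_eq continuous_intros)
  then show ?thesis unfolding real_elements_def by (intro closed_Collect_all)
qed

lemma prob_spaces: "prob_space (m x)" "prob_space \<mu>0"
  and sets_spaces [simp, measurable_cong]: "sets (m x) = sets borel" "sets \<mu>0 = sets borel"
  using kernel_prob_space[OF kernel, of x] prob_\<mu>0 by (auto simp: space_prob_algebra)

lemma val_integrable: "integrable (m x) (val g)" "integrable \<mu>0 (val g)"
proof -
  interpret m: prob_space "m x" by (rule prob_spaces)
  interpret \<mu>: prob_space \<mu>0 by (rule prob_spaces)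
  show "integrable (m x) (val g)" by (rule m.integrable_const_bound[of _ "norm g"]) (auto simp: val_bounded)
  show "integrable \<mu>0 (val g)" by (rule \<mu>.integrable_const_bound[of _ "norm g"]) (auto simp: val_bounded)
qed

lemma
  assumes "g \<in> real_elements"
  shows val_L0: "val (L0 g) = averaging m (val g)" and real_L0: "L0 g \<in> real_elements"
proof -
  have "ev (L0 g) = (\<lambda>x. of_real (averaging m (val g) x))"
    unfolding ev_L0 by (subst ev_val[OF assms]) (auto simp: averaging_def fun_eq_iff val_integrable)
  from val_eqI[OF this] show "val (L0 g) = averaging m (val g)" "L0 g \<in> real_elements" by auto
qed

lemma mean_L0:
  assumes g: "g \<in> real_elements"
  shows "mean (L0 g) = mean g"
proof -
  interpret \<mu>: prob_space \<mu>0 by (rule prob_spaces)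
  have "(\<integral>x. val g x \<partial>(\<mu>0 \<bind> m)) = (\<integral>x. (\<integral>y. val g y \<partial>m x) \<partial>\<mu>0)"
  proof (rule integral_bind[where B = "norm g" and B' = 1 and K = borel])
    show "m \<in> \<mu>0 \<rightarrow>\<^sub>M subprob_algebra borel"
      using measurable_prob_algebraD[OF kernel] by (simp add: measurable_cong_sets[OF sets_spaces(2) refl])
    show "AE x in \<mu>0. emeasure (m x) (space (m x)) \<le> ennreal 1"
      using prob_space.emeasure_space_1[OF prob_spaces(1)] by simp
  qed (auto simp: val_bounded intro: \<mu>.finite_measure_axioms)
  then show ?thesis unfolding stationary mean_def val_L0[OF g] averaging_def by simp
qed

lemma mean_zero_in_G0:
  assumes "g \<in> real_elements" "mean g = 0"
  shows "g \<in> G0"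
  using assms(2) unfolding G0_eq mean_def by (simp add: ev_val[OF assms(1)] val_integrable)

sublocale gap_subalgebra real_elements mean L0 \<delta>0
proof (rule gap_subalgebra.intro)
  show "subspace real_elements" by (auto simp: subspace_def real_add real_scaleR real_zero)
  show "closed real_elements" by (rule closed_real_elements)
  show "bounded_linear L0" by (rule bounded_L0)
  show "L0 1 = 1"
  proof (rule injD[OF inj_ev])
    have "ev (L0 1) = averaging m (\<lambda>_. 1)" by (simp add: ev_L0 ev_one)
    then show "ev (L0 1) = ev 1"
      using prob_space.prob_space[OF prob_spaces(1)] by (auto simp: averaging_def ev_one fun_eq_iff)
  qed
  interpret \<mu>: prob_space \<mu>0 by (rule prob_spaces)
  show "mean 1 = 1" by (simp add: mean_def val_one \<mu>.prob_space)
  fix g h assume g: "g \<in> real_elements"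
  show "mean (r *\<^sub>R g) = r * mean g" for r by (simp add: mean_def val_scaleR[OF g])
  show "mean (L0 g) = mean g" by (rule mean_L0[OF g])
  show "\<bar>mean g\<bar> \<le> norm g"
  proof -
    have "\<bar>mean g\<bar> \<le> (\<integral>x. \<bar>val g x\<bar> \<partial>\<mu>0)" unfolding mean_def by (rule integral_abs_bound)
    also have "\<dots> \<le> norm g"
      by (rule \<mu>.integral_le_const) (auto simp: val_bounded val_integrable)
    finally show ?thesis .
  qed
  show "L0 g \<in> real_elements" by (rule real_L0[OF g])
  show "mean g = 0 \<Longrightarrow> norm (L0 g) \<le> (1 - \<delta>0) * norm g" using contraction mean_zero_in_G0[OF g] by blast
  assume h: "h \<in> real_elements"
  show "g * h \<in> real_elements" by (rule real_mult[OF g h])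
  show "mean (g + h) = mean g + mean h"
    unfolding mean_def val_add[OF g h] by (intro Bochner_Integration.integral_add val_integrable)
qed (use gap real_one in auto)

lemma val_diff:
  assumes g: "g \<in> real_elements" and h: "h \<in> real_elements"
  shows "val (g - h) = (\<lambda>x. val g x - val h x)"
  using val_add[OF g real_scaleR[OF h, of "-1"]] val_scaleR[OF h, of "-1"] by simp

lemma val_centre: "g \<in> real_elements \<Longrightarrow> val (centre g) = (\<lambda>x. val g x - mean g)"
  unfolding centre_def by (simp add: val_diff val_scaleR real_one real_scaleR val_one)

lemma val_L0_iterate:
  assumes "g \<in> real_elements"
  shows "(L0 ^^ k) g \<in> real_elements" "val ((L0 ^^ k) g) = (averaging m ^^ k) (val g)"
  by (induction k) (use assms in \<open>auto simp: real_L0 val_L0\<close>)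

lemma dyn_variance_eq:
  assumes g: "g \<in> real_elements"
  shows "dyn_variance m \<mu>0 (val g) = gap_variance g"
proof -
  have "mean (g * (L0 ^^ Suc k) (centre g))
      = (\<integral>x. val g x * (averaging m ^^ Suc k) (\<lambda>y. val g y - mean g) x \<partial>\<mu>0)" for k
    using val_L0_iterate[OF centre_V[OF g], of "Suc k"] val_mult[OF g, of "(L0 ^^ Suc k) (centre g)"]
    by (simp add: mean_def[of "g * _"] val_centre[OF g])
  then show ?thesis
    unfolding dyn_variance_def gap_variance_def
    by (simp add: mean_def[of "g * g"] val_mult[OF g g] power2_eq_square mean_def[of g, symmetric])
qed

lemma val_exp:
  assumes g: "g \<in> real_elements"
  shows "val (exp g) = (\<lambda>x. exp (val g x))"
proof (rule val_eqI)
  show "ev (exp g) = (\<lambda>x. of_real (exp (val g x)))"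
  proof
    fix x
    have power: "ev (g ^ k) x = ev g x ^ k" for k by (induction k) (auto simp: ev_one ev_mult)
    have "(\<lambda>k. ev (g ^ k /\<^sub>R fact k) x) sums ev (exp g) x"
      by (rule bounded_linear.sums[OF ev_bounded_linear exp_converges])
    then have "(\<lambda>k. ev g x ^ k /\<^sub>R fact k) sums ev (exp g) x" by (simp add: ev_scaleR power)
    then have "ev (exp g) x = exp (ev g x)" using exp_converges sums_unique2 by blast
    then show "ev (exp g) x = of_real (exp (val g x))" by (simp add: ev_val[OF g] exp_of_real)
  qed
qed

text \<open>
  The recursion of \<open>exp_moment\<close> is the twisted operator, read pointwise; boundedness and positivity of the
  iterates allow passing from the extended to the real integral.
\<close>

lemma exp_moment_eq_twist:
  assumes tw: "small_twist real_elements mean L0 \<delta>0 f t"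
  shows "exp_moment m (\<lambda>x. t * val f x) n x = ennreal (val ((small_twist.twist L0 f t ^^ n) 1) x)"
proof -
  interpret small_twist real_elements mean L0 \<delta>0 f t by (rule tw)
  have "exp_moment m (\<lambda>x. t * val f x) n x = ennreal (val ((twist ^^ n) 1) x) \<and>
     0 \<le> val ((twist ^^ n) 1) x \<and> (twist ^^ n) 1 \<in> real_elements" for x
  proof (induction n arbitrary: x)
    case 0
    show ?case by (simp add: val_one real_one)
  next
    case (Suc n)
    let ?F = "(twist ^^ n) 1"
    have F: "?F \<in> real_elements" "0 \<le> val ?F y" "exp_moment m (\<lambda>x. t * val f x) n y = ennreal (val ?F y)" for y
      using Suc[of y] by auto
    have tf: "t *\<^sub>R f \<in> real_elements" using f_V by (rule V_scale)
    have prod: "exp (t *\<^sub>R f) * ?F \<in> real_elements" by (intro V_mult V_exp tf F(1))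
    have valp: "val (exp (t *\<^sub>R f) * ?F) = (\<lambda>y. exp (t * val f y) * val ?F y)"
      by (simp add: val_mult[OF V_exp[OF tf] F(1)] val_exp[OF tf] val_scaleR[OF f_V])
    have twist_Suc: "(twist ^^ Suc n) 1 = L0 (exp (t *\<^sub>R f) * ?F)" by (simp add: twist_def[of ?F])
    have val': "val ((twist ^^ Suc n) 1) x = (\<integral>y. exp (t * val f y) * val ?F y \<partial>m x)"
      by (simp add: twist_Suc val_L0[OF prod] valp averaging_def del: funpow.simps)
    have "exp_moment m (\<lambda>x. t * val f x) (Suc n) x = (\<integral>\<^sup>+y. ennreal (exp (t * val f y) * val ?F y) \<partial>m x)"
      using F by (simp add: ennreal_mult)
    also have "\<dots> = ennreal (\<integral>y. exp (t * val f y) * val ?F y \<partial>m x)"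
      using val_integrable(1)[of x "exp (t *\<^sub>R f) * ?F"] F(2) unfolding valp
      by (intro nn_integral_eq_integral) auto
    finally show ?case
      using F(2) real_L0[OF prod] unfolding val' unfolding twist_Suc by (simp add: integral_nonneg_AE)
  qed
  then show ?thesis by blast
qed

lemma exp_sum_moment_le:
  assumes mc: "markov_chain P m \<mu> X" and f: "f \<in> real_elements"
    and small: "exp (\<bar>t\<bar> * norm f) - 1 \<le> \<delta>0\<^sup>2 / (12 + 13 * \<delta>0)"
  shows "(\<integral>\<^sup>+w. ennreal (exp (t * (\<Sum>i=1..n. val f (X i w)))) \<partial>P)
    \<le> ennreal (1.3185 * exp (real n * (t * mean f + t\<^sup>2 / 2 * gap_variance f
         + 10 * (1 + 1 / \<delta>0)\<^sup>2 * (\<bar>t\<bar> * norm f) ^ 3)))"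
    (is "_ \<le> ennreal ?C")
proof -
  interpret tw: small_twist real_elements mean L0 \<delta>0 f t by unfold_locales (rule f, rule small)
  interpret P: prob_space P using mc by (simp add: markov_chain_def)
  have "(\<integral>\<^sup>+w. ennreal (exp (t * (\<Sum>i=1..n. val f (X i w)))) \<partial>P)
      = (\<integral>\<^sup>+w. exp_moment m (\<lambda>x. t * val f x) n (X 0 w) \<partial>P)"
  proof -
    have "\<bar>t * val f x\<bar> \<le> \<bar>t\<bar> * norm f" for x unfolding abs_mult by (intro mult_left_mono val_bounded) auto
    then show ?thesis
      using nn_integral_exp_sum[OF mc kernel, of "\<lambda>x. t * val f x" "\<bar>t\<bar> * norm f" 0 n]
      by (simp add: sum_distrib_left)
  qed
  also have "\<dots> \<le> (\<integral>\<^sup>+w. ennreal ?C \<partial>P)"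
  proof (rule nn_integral_mono)
    fix w
    have "val ((tw.twist ^^ n) 1) (X 0 w) \<le> ?C"
      using val_bounded[of "(tw.twist ^^ n) 1" "X 0 w"] tw.norm_twist_iterate_le[of n]
      unfolding tw.log_rate_def tw.s_def by linarith
    then show "exp_moment m (\<lambda>x. t * val f x) n (X 0 w) \<le> ennreal ?C"
      unfolding exp_moment_eq_twist[OF tw.small_twist_axioms] by (rule ennreal_leI)
  qed
  also have "\<dots> = ennreal ?C" by (simp add: P.emeasure_space_1)
  finally show ?thesis .
qed

end

section \<open>Large deviations of the empirical mean\<close>

lemma threshold_pos: "0 < \<delta> \<Longrightarrow> 0 < threshold \<delta>"
  unfolding threshold_def by (intro ln_gt_zero) (simp add: add_pos_pos)

text \<open>
  Chernoff's inequality for \<open>t S\<^sub>n\<close>. As \<open>t\<close> may have either sign, this covers both tails.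
\<close>

lemma (in contracting_kernel) deviation_prob_le:
  assumes mc: "markov_chain P m \<mu> X" and f: "f \<in> real_elements"
    and small: "exp (\<bar>t\<bar> * norm f) - 1 \<le> \<delta>0\<^sup>2 / (12 + 13 * \<delta>0)"
  shows "measure P {w \<in> space P. t * (\<Sum>i=1..n. val f (X i w)) \<ge> real n * (t * mean f + b)}
    \<le> 1.3185 * exp (real n * (t\<^sup>2 / 2 * gap_variance f + 10 * (1 + 1 / \<delta>0)\<^sup>2 * (\<bar>t\<bar> * norm f) ^ 3 - b))"
    (is "measure P ?A \<le> ?R")
proof -
  interpret prob_space P using mc by (simp add: markov_chain_def)
  have [measurable]: "X i \<in> P \<rightarrow>\<^sub>M borel" for i using mc by (simp add: markov_chain_def)
  let ?c = "real n * (t * mean f + b)"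
  let ?Z = "\<lambda>w. t * (\<Sum>i=1..n. val f (X i w))"
  have "emeasure P ?A \<le> ennreal (exp (- 1 * ?c)) * (\<integral>\<^sup>+w. ennreal (exp (1 * ?Z w)) * indicator (space P) w \<partial>P)"
    by (rule Chernoff_ineq_nn_integral_ge) auto
  also have "(\<integral>\<^sup>+w. ennreal (exp (1 * ?Z w)) * indicator (space P) w \<partial>P) = (\<integral>\<^sup>+w. ennreal (exp (?Z w)) \<partial>P)"
    by (intro nn_integral_cong) simp
  also have "ennreal (exp (- 1 * ?c)) * \<dots> \<le> ennreal (exp (- 1 * ?c)) * ennreal (1.3185 * exp (real n *
      (t * mean f + t\<^sup>2 / 2 * gap_variance f + 10 * (1 + 1 / \<delta>0)\<^sup>2 * (\<bar>t\<bar> * norm f) ^ 3)))"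
    by (intro mult_left_mono exp_sum_moment_le[OF mc f small]) simp
  also have "\<dots> = ennreal ?R"
    by (simp add: ennreal_mult[symmetric] exp_add[symmetric] algebra_simps)
  finally show ?thesis by (simp add: emeasure_eq_measure)
qed

text \<open>
  The choice \<open>t = a / U\<close> minimises \<open>t\<^sup>2 U / 2 - t a\<close>, the quadratic part of the exponent, and the hypothesis on \<open>a\<close> is
  exactly the smallness of the twist for this \<open>t\<close>.
\<close>

lemma (in contracting_kernel) empirical_mean_deviation:
  assumes mc: "markov_chain P m \<mu> X" and f: "f \<in> real_elements" "f \<noteq> 0"
    and a: "a > 0" and n: "n \<ge> 1"
    and U: "U \<ge> gap_variance f" "a \<le> U / norm f * threshold \<delta>0"
  shows "measure P {w \<in> space P. \<bar>empirical_mean X (val f) n w - mean f\<bar> \<ge> a}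
    \<le> tail_bound n \<delta>0 (norm f) a U"
proof -
  interpret prob_space P using mc by (simp add: markov_chain_def)
  have [measurable]: "X i \<in> P \<rightarrow>\<^sub>M borel" for i using mc by (simp add: markov_chain_def)
  have N: "norm f > 0" using f by simp
  have q: "0 < \<delta>0\<^sup>2 / (12 + 13 * \<delta>0)" using gap by simp
  note th = threshold_pos[OF gap(1)]
  have "0 < U / norm f * threshold \<delta>0" using U(2) a by linarith
  then have U0: "0 < U" using th N by (simp add: zero_less_mult_iff zero_less_divide_iff)
  define t where "t = a / U"
  have t: "0 < t" using a U0 by (simp add: t_def)
  define s where "s = t * norm f"
  have "s \<le> threshold \<delta>0" using U(2) U0 N by (simp add: s_def t_def field_simps)
  then have "exp s \<le> exp (threshold \<delta>0)" by simp
  also have "\<dots> = 1 + \<delta>0\<^sup>2 / (12 + 13 * \<delta>0)" using q by (simp add: threshold_def)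
  finally have small: "exp s - 1 \<le> \<delta>0\<^sup>2 / (12 + 13 * \<delta>0)" by simp
  let ?S = "\<lambda>w. \<Sum>i=1..n. val f (X i w)"
  let ?A = "\<lambda>r. {w \<in> space P. r * ?S w \<ge> real n * (r * mean f + t * a)}"
  have half: "measure P (?A r) \<le> tail_bound n \<delta>0 (norm f) a U / 2" if r: "\<bar>r\<bar> = t" for r
  proof -
    have "r\<^sup>2 = t\<^sup>2" using r by (metis power2_abs)
    then have "measure P (?A r) \<le> 1.3185 * exp (real n * (t\<^sup>2 / 2 * gap_variance f
        + 10 * (1 + 1 / \<delta>0)\<^sup>2 * s ^ 3 - t * a))"
      using deviation_prob_le[OF mc f(1), of r n "t * a"] small unfolding r s_def by simp
    also have "\<dots> \<le> 1.3185 * exp (real n * (t\<^sup>2 / 2 * U + 10 * (1 + 1 / \<delta>0)\<^sup>2 * s ^ 3 - t * a))"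
      using U(1) by (intro mult_left_mono iffD2[OF exp_le_cancel_iff] add_right_mono diff_right_mono) auto
    also have "t\<^sup>2 / 2 * U + 10 * (1 + 1 / \<delta>0)\<^sup>2 * s ^ 3 - t * a
        = - (a\<^sup>2 / (2 * U) - 10 * (1 + inverse \<delta>0)\<^sup>2 * (norm f ^ 3 * a ^ 3 / U ^ 3))"
    proof -
      have "t\<^sup>2 / 2 * U - t * a = - (a\<^sup>2 / (2 * U))" using U0 by (simp add: t_def field_simps power2_eq_square)
      moreover have "s ^ 3 = norm f ^ 3 * a ^ 3 / U ^ 3"
        by (simp add: s_def t_def power_mult_distrib power_divide)
      ultimately show ?thesis by (simp add: inverse_eq_divide)
    qed
    finally show ?thesis unfolding tail_bound_def mult_minus_left mult_minus_right by simp
  qed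
  have "{w \<in> space P. \<bar>empirical_mean X (val f) n w - mean f\<bar> \<ge> a} \<subseteq> ?A t \<union> ?A (- t)"
  proof safe
    fix w assume dev: "a \<le> \<bar>empirical_mean X (val f) n w - mean f\<bar>" and "w \<in> space P"
      and not: "\<not> real n * (- t * mean f + t * a) \<le> - t * ?S w"
    have S: "?S w = real n * empirical_mean X (val f) n w" using n by (simp add: empirical_mean_def)
    have pos: "0 < real n * t" using n t by simp
    show "real n * (t * mean f + t * a) \<le> t * ?S w"
    proof (cases "empirical_mean X (val f) n w \<ge> mean f + a")
      case True
      then show ?thesis
        using mult_left_mono[OF True less_imp_le[OF pos]] unfolding S by (simp add: algebra_simps)
    next
      case False
      then have "empirical_mean X (val f) n w \<le> mean f - a" using dev by linarith
      from mult_left_mono[OF this less_imp_le[OF pos]] not show ?thesis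
        unfolding S by (simp add: algebra_simps)
    qed
  qed
  then have "measure P {w \<in> space P. \<bar>empirical_mean X (val f) n w - mean f\<bar> \<ge> a} \<le> measure P (?A t \<union> ?A (- t))"
    by (intro finite_measure_mono) measurable
  also have "\<dots> \<le> measure P (?A t) + measure P (?A (- t))"
    by (intro measure_Un_le) measurable
  also have "\<dots> \<le> tail_bound n \<delta>0 (norm f) a U"
    using half[of t] half[of "- t"] t by simp
  finally show ?thesis .
qed

section \<open>The optimal parameter in the tail bound\<close>

text \<open>
  The cubic \<open>A p - B p\<^sup>3\<close> has its maximum on the positive half-line where \<open>3 B p\<^sup>2 = A\<close>. Hence \<open>q\<close> beats \<open>p\<close> if \<open>q\<close> is
  that point, or if \<open>q\<close> lies between \<open>p\<close> and that point.
\<close>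

lemma cubic_exponent_le:
  fixes p q A B :: real
  assumes B: "0 \<le> B" and p: "0 \<le> p" and q: "0 \<le> q"
    and le: "3 * B * q\<^sup>2 \<le> A" and eq: "q < p \<Longrightarrow> 3 * B * q\<^sup>2 = A"
  shows "A * p - B * p ^ 3 \<le> A * q - B * q ^ 3"
proof -
  have factor: "(A * q - B * q ^ 3) - (A * p - B * p ^ 3) = (q - p) * (A - B * (q\<^sup>2 + q * p + p\<^sup>2))"
    by (simp add: power2_eq_square power3_eq_cube algebra_simps)
  have "0 \<le> (q - p) * (A - B * (q\<^sup>2 + q * p + p\<^sup>2))"
  proof (cases "q < p")
    case True
    have "q\<^sup>2 + q * q + q\<^sup>2 \<le> q\<^sup>2 + q * p + p\<^sup>2"
      using True p q by (intro add_mono mult_left_mono power_mono) auto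
    from mult_left_mono[OF this B] have "A \<le> B * (q\<^sup>2 + q * p + p\<^sup>2)"
      using eq[OF True] by (simp add: power2_eq_square algebra_simps)
    then show ?thesis using True by (intro mult_nonpos_nonpos) auto
  next
    case False
    have "q\<^sup>2 + q * p + p\<^sup>2 \<le> q\<^sup>2 + q * q + q\<^sup>2"
      using False p q by (intro add_mono mult_left_mono power_mono) auto
    from mult_left_mono[OF this B] have "B * (q\<^sup>2 + q * p + p\<^sup>2) \<le> A"
      using le by (simp add: power2_eq_square algebra_simps)
    then show ?thesis using False by (intro mult_nonneg_nonneg) auto
  qed
  with factor show ?thesis by simp
qed

text \<open>
  In the variable \<open>1 / U\<close> the exponent is \<open>- n\<close> times a cubic with critical point \<open>1 / u\<close>, where \<open>u\<^sup>2 = 60 (1 + 1/\<delta>\<^sub>0)\<^sup>2 N\<^sup>3 a\<close>. The minimiser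
  is \<open>u\<close> if \<open>u\<close> is admissible, and otherwise the left end of the admissible interval.
\<close>

lemma tail_bound_minimal:
  fixes \<delta>0 N a S U :: real
  assumes pos: "0 < \<delta>0" "0 < N" "0 < a"
    and U: "max S (a * N / threshold \<delta>0) \<le> U" and th: "0 < threshold \<delta>0"
  defines "V \<equiv> max (max S (sqrt a * sqrt 60 * (1 + inverse \<delta>0) * N powr (3 / 2))) (a * (N / threshold \<delta>0))"
  shows "tail_bound n \<delta>0 N a V \<le> tail_bound n \<delta>0 N a U"
proof -
  define C where "C = 10 * (1 + inverse \<delta>0)\<^sup>2 * (N ^ 3 * a ^ 3)"
  define u where "u = sqrt a * sqrt 60 * (1 + inverse \<delta>0) * N powr (3 / 2)"
  have "0 < a * N / threshold \<delta>0" using pos th by simp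
  moreover have "a * N / threshold \<delta>0 \<le> U" "a * N / threshold \<delta>0 \<le> V" using U by (auto simp: V_def)
  ultimately have U0: "0 < U" and V0: "0 < V" by linarith+
  have u0: "0 < u" using pos by (simp add: u_def add_pos_pos)
  have "(N powr (3 / 2))\<^sup>2 = N ^ 3"
    using pos by (simp add: power2_eq_square powr_add[symmetric])
  then have "u\<^sup>2 = a * 60 * (1 + inverse \<delta>0)\<^sup>2 * N ^ 3"
    using pos by (simp add: u_def power_mult_distrib)
  then have u2: "a\<^sup>2 * u\<^sup>2 = 6 * C" by (simp add: C_def power2_eq_square power3_eq_cube)
  have "u \<le> V" by (simp add: V_def u_def)
  have "(1 / V)\<^sup>2 \<le> (1 / u)\<^sup>2" using \<open>u \<le> V\<close> u0 by (intro power_mono divide_left_mono) auto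
  have C0: "0 \<le> C" using pos by (simp add: C_def)
  have at_u: "3 * C * (1 / u)\<^sup>2 = a\<^sup>2 / 2" using u2 u0 by (simp add: field_simps power2_eq_square)
  have "a\<^sup>2 / 2 * (1 / U) - C * (1 / U) ^ 3 \<le> a\<^sup>2 / 2 * (1 / V) - C * (1 / V) ^ 3"
  proof (rule cubic_exponent_le[OF C0])
    show "3 * C * (1 / V)\<^sup>2 \<le> a\<^sup>2 / 2"
      using mult_left_mono[OF \<open>(1 / V)\<^sup>2 \<le> (1 / u)\<^sup>2\<close>, of "3 * C"] C0 at_u by simp
    assume "1 / V < 1 / U"
    then have "U < V" using U0 V0 by (simp add: field_simps)
    then have "V = u" using U by (auto simp: V_def u_def max_def split: if_splits)
    then show "3 * C * (1 / V)\<^sup>2 = a\<^sup>2 / 2" using at_u by simp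
  qed (use U0 V0 in auto)
  then have "- real n * (a\<^sup>2 / 2 * (1 / V) - C * (1 / V) ^ 3) \<le> - real n * (a\<^sup>2 / 2 * (1 / U) - C * (1 / U) ^ 3)"
    by (rule mult_left_mono_neg) simp
  moreover have "tail_bound n \<delta>0 N a W = 2.637 * exp (- real n * (a\<^sup>2 / 2 * (1 / W) - C * (1 / W) ^ 3))" for W
    by (simp add: tail_bound_def C_def power_divide)
  ultimately show ?thesis by (simp only:) simp
qed

section \<open>The concentration inequality\<close>

theorem theorem2:
  fixes ev :: "'x :: {real_normed_algebra_1, banach} \<Rightarrow> 'a :: polish_space \<Rightarrow>
                 'k :: {real_normed_field, banach, second_countable_topology}"
    and scl :: "'k \<Rightarrow> 'x \<Rightarrow> 'x"
    and m :: "'a \<Rightarrow> 'a measure"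
    and L0 :: "'x \<Rightarrow> 'x"
    and \<mu>0 \<mu> :: "'a measure"
    and G0 :: "'x set"
    and \<delta>0 a :: real
    and P :: "'w measure"
    and X :: "nat \<Rightarrow> 'w \<Rightarrow> 'a"
    and f :: 'x
    and \<phi> :: "'a \<Rightarrow> real"
    and n :: nat
  assumes "contracting_kernel ev scl m L0 \<mu>0 G0 \<delta>0"
    and "markov_chain P m \<mu> X"
    and "ev f = (\<lambda>x. of_real (\<phi> x))"
    and "f \<noteq> 0"
    and "a > 0"
    and "real n \<ge> 1 + ln 100 / (- ln (1 - \<delta>0 / 13))"
  shows "(\<forall>U. U \<ge> dyn_variance m \<mu>0 \<phi> \<and> a \<le> U / norm f * threshold \<delta>0 \<longrightarrow>
            \<P>(w in P. \<bar>empirical_mean X \<phi> n w - (\<integral>x. \<phi> x \<partial>\<mu>0)\<bar> \<ge> a)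
              \<le> tail_bound n \<delta>0 (norm f) a U) \<and>
         (\<forall>S. S \<ge> dyn_variance m \<mu>0 \<phi> \<longrightarrow>
            is_arg_min (tail_bound n \<delta>0 (norm f) a)
              (\<lambda>U. U \<in> {max S (a * norm f / threshold \<delta>0)..})
              (max (max S (sqrt a * sqrt 60 * (1 + inverse \<delta>0) * norm f powr (3 / 2)))
                   (a * (norm f / threshold \<delta>0))))"
proof -
  interpret contracting_kernel ev scl m L0 \<mu>0 G0 \<delta>0 by (rule assms(1))
  have f: "val f = \<phi>" "f \<in> real_elements" using val_eqI[OF assms(3)] by auto
  have var: "dyn_variance m \<mu>0 \<phi> = gap_variance f" using dyn_variance_eq[OF f(2)] f(1) by simp
  have mean: "(\<integral>x. \<phi> x \<partial>\<mu>0) = mean f" by (simp add: mean_def f(1))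
  have "ln (1 - \<delta>0 / 13) < 0" using gap by (intro ln_less_zero) auto
  then have "0 \<le> ln 100 / (- ln (1 - \<delta>0 / 13))" by (intro divide_nonneg_nonneg) auto
  with assms(6) have n: "n \<ge> 1" by linarith
  note th = threshold_pos[OF gap(1)]
  show ?thesis
  proof (intro conjI allI impI; (elim conjE)?)
    fix U assume "dyn_variance m \<mu>0 \<phi> \<le> U" "a \<le> U / norm f * threshold \<delta>0"
    then show "\<P>(w in P. \<bar>empirical_mean X \<phi> n w - (\<integral>x. \<phi> x \<partial>\<mu>0)\<bar> \<ge> a) \<le> tail_bound n \<delta>0 (norm f) a U"
      using empirical_mean_deviation[OF assms(2) f(2) assms(4,5) n, of U] unfolding var mean f(1) by blast
  next
    fix S assume "dyn_variance m \<mu>0 \<phi> \<le> S"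
    show "is_arg_min (tail_bound n \<delta>0 (norm f) a)
              (\<lambda>U. U \<in> {max S (a * norm f / threshold \<delta>0)..})
              (max (max S (sqrt a * sqrt 60 * (1 + inverse \<delta>0) * norm f powr (3 / 2)))
                   (a * (norm f / threshold \<delta>0)))"
      using tail_bound_minimal[OF gap(1) _ assms(5) _ th, of "norm f" S _ n] assms(4)
      unfolding is_arg_min_def by (auto simp: not_less)
  qed
qed

end
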